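(* Let $f,g_1,\dots,g_m\in\operatorname{Sym}\mathbb R\langle\mathbf q,\bar{\mathbf q}\rangle$ and $h_1,\dots,h_\ell\in\mathbb R\langle\mathbf q,\bar{\mathbf q}\rangle$. Assume that $\mathcal Q^{\mathbb R}(\mathbf g,\mathbf h)$ is Archimedean. Then $f_d^*\nearrow f_{\min}$ and $f_d\nearrow f_{\min}$ as $d\to\infty$ (monotone nondecreasing convergence), where $f_{\min}$ is the optimal value of minimizing $f(\mathbf q,\bar{\mathbf q})$ over $K_{\mathbf g,\mathbf h}$ and $f_d$, $f_d^*$ are the optimal values of the order-$d$ moment and QSOS relaxations defined in the context.
   Context: $\mathbb H$ is the skew field of quaternions. Fix $n\ge1$ and letters $q_1,\dots,q_n,\bar q_1,\dots,\bar q_n$. $\mathcal W$ is the set of words (including the empty word $1$) in these letters, where words with the same normal form are identified: any consecutive factor $q_i\bar q_i$ or $\bar q_iq_i$ is written $|q_i|^2$ and moved to the front, so each word is uniquely $\prod_i|q_i|^{2\alpha_i}\tilde w$ with $\tilde w$ containing no such factor. $|w|$ is the length, $\mathcal W_t$ the words of length at most $t$; $w^*$ is obtained by reversing $w$ and exchanging $q_i\leftrightarrow\bar q_i$. $\mathcal F_n=\mathbb R\langle\mathbf q,\bar{\mathbf q}\rangle$ is the real $*$-algebra of finite sums $\sum_wp_ww$, $p_w\in\mathbb R$, with $p^*=\sum p_ww^*$, $\deg p=\max\{|w|:p_w\ne0\}$; $\mathbb R\langle\mathbf q,\bar{\mathbf q}\rangle_{2d}$ is the subspace of degree at most $2d$;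 $\operatorname{Sym}$ denotes elements with $p=p^*$; $[a,b]$ is the commutator. Words $u,v$ are cyclically equivalent, $u\stackrel{\mathrm{cyc}}{\sim}v$, if $u=w_1w_2$, $v=w_2w_1$ for some words. $K_{\mathbf g,\mathbf h}=\{\mathbf a\in\mathbb H^n:g_i(\mathbf a,\bar{\mathbf a})\ge0\ (1\le i\le m),\ h_j(\mathbf a,\bar{\mathbf a})=0\ (1\le j\le\ell)\}$ (evaluation $q_i\mapsto a_i$, $\bar q_i\mapsto\bar a_i$); $f_{\min}=\inf_{K_{\mathbf g,\mathbf h}}f$, with $f_{\min}=+\infty$ if $K_{\mathbf g,\mathbf h}=\varnothing$. $\mathcal I_n^{\mathbb R}$ is the ideal of all $p\in\mathcal F_n$ vanishing under evaluation at every $\mathbf a\in\mathbb H^n$. $\Sigma^{\mathbb R}$ is the set of finite sums $\sum_sp_s^*p_s$, $p_s\in\mathcal F_n$, and $\Sigma_d^{\mathbb R}=\Sigma^{\mathbb R}\cap\mathbb R\langle\mathbf q,\bar{\mathbf q}\rangle_{2d}$. $\mathcal Q^{\mathbb R}(\mathbf g,\mathbf h)$ is the set of all finite expressions $$\sigma_0+\tfrac12\sum_{i=1}^m(\sigma_ig_i+g_i\sigma_i)+\sum_{j=1}^\ell\sum_\alpha(\tau_{j\alpha}h_j\nu_{j\alpha}+\nu_{j\alpha}^*h_j^*\tau_{j\alpha}^* ),\quad\sigma_i\in\Sigma^{\mathbb R},\ \tau_{j\alpha},\nu_{j\alpha}\in\mathcal F_n;$$ it is Archimedean if $R-\sum_{i=1}^n|q_i|^2\in\mathcal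 Q^{\mathbb R}(\mathbf g,\mathbf h)$ for some $R>0$. $\mathcal Q^{\mathbb R}(\mathbf g,\mathbf h)_{2d}$ is the subset of such expressions with $\sigma_0\in\Sigma_d^{\mathbb R}$, $\sigma_i\in\Sigma^{\mathbb R}_{d-\lceil\deg(g_i)/2\rceil}$, $\deg\tau_{j\alpha}+\deg\nu_{j\alpha}\le2d-\deg h_j$. Here $d$ ranges over integers large enough that $2d$ is at least the degrees of $f$, all $g_i$ and all $h_j$. For $\mathbf y=(y_w)_{w\in\mathcal W_{2d}}$ real, $L_{\mathbf y}(\sum p_ww)=\sum p_wy_w$, $[\mathbf M_t(\mathbf y)]_{u,v}=L_{\mathbf y}(u^*v)$ and $[\mathbf M_t(g\mathbf y)]_{u,v}=L_{\mathbf y}(u^*gv)$ for $u,v\in\mathcal W_t$. Moment relaxation: $f_d$ is the infimum of $L_{\mathbf y}(f)$ over real $\mathbf y=(y_w)_{w\in\mathcal W_{2d}}$ with $y_1=1$; $y_w=y_{w^*}$; $y_u=y_v$ whenever $u\stackrel{\mathrm{cyc}}{\sim}v$; $\mathbf M_d(\mathbf y)\succeq0$; $\mathbf M_{d-\lceil\deg(g_i)/2\rceil}(g_i\mathbf y)\succeq0$ for all $i$; $L_{\mathbf y}(uh_jv)=0$ for all $j$ and words $u,v$ with $|u|+|v|\le2d-\deg h_j$; and $L_{\mathbf y}(u[w+w^*,q_i]v)=0$ for all $i$ and words with $|u|+|v|+|w|\le2d-1$. QSOS relaxation: $f_d^*=\sup\{\lambda\in\mathbb R: f-\lambda\in\mathcal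 Q^{\mathbb R}(\mathbf g,\mathbf h)_{2d}+(\mathcal I_n^{\mathbb R}\cap\operatorname{Sym}\mathbb R\langle\mathbf q,\bar{\mathbf q}\rangle_{2d})\}$. Conventions: $\inf\varnothing=+\infty$, $\sup\varnothing=-\infty$. *)

theory Defs
  imports
    "HOL-Library.Extended_Real"
    "HOL-Library.Nonpos_Ints"
    "HOL-Library.Poly_Mapping"
begin

section \<open>Quaternions\<close>

datatype quat = Quat (qRe: real) (qI: real) (qJ: real) (qK: real)

lemma quat_eq_iff:
  "x = y \<longleftrightarrow> qRe x = qRe y \<and> qI x = qI y \<and> qJ x = qJ y \<and> qK x = qK y"
  by (cases x; cases y) auto

instantiation quat :: real_div_algebra
begin

definition "0 = Quat 0 0 0 0"
definition "1 = Quat 1 0 0 0"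
definition "x + y = Quat (qRe x + qRe y) (qI x + qI y) (qJ x + qJ y) (qK x + qK y)"
definition "- x = Quat (- qRe x) (- qI x) (- qJ x) (- qK x)"
definition "x - y = Quat (qRe x - qRe y) (qI x - qI y) (qJ x - qJ y) (qK x - qK y)"
definition "x * y = Quat
  (qRe x * qRe y - qI x * qI y - qJ x * qJ y - qK x * qK y)
  (qRe x * qI y + qI x * qRe y + qJ x * qK y - qK x * qJ y)
  (qRe x * qJ y - qI x * qK y + qJ x * qRe y + qK x * qI y)
  (qRe x * qK y + qI x * qJ y - qJ x * qI y + qK x * qRe y)"
definition "scaleR r x = Quat (r * qRe x) (r * qI x) (r * qJ x) (r * qK x)" for x :: quat
definition "inverse x = scaleR (inverse ((qRe x)\<^sup>2 + (qI x)\<^sup>2 + (qJ x)\<^sup>2 + (qK x)\<^sup>2))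
  (Quat (qRe x) (- qI x) (- qJ x) (- qK x))"
definition "x div y = x * inverse y" for x y :: quat

lemmas quat_defs = zero_quat_def one_quat_def plus_quat_def uminus_quat_def minus_quat_def
  times_quat_def scaleR_quat_def inverse_quat_def divide_quat_def

instance
proof
  fix x y z :: quat and r s :: real
  note [simp] = quat_eq_iff quat_defs
  show "x + y + z = x + (y + z)" "x + y = y + x" "0 + x = x" "- x + x = 0" "x - y = x + - y"
    by simp_all
  show "r *\<^sub>R (x + y) = r *\<^sub>R x + r *\<^sub>R y" "(r + s) *\<^sub>R x = r *\<^sub>R x + s *\<^sub>R x"
    "r *\<^sub>R s *\<^sub>R x = (r * s) *\<^sub>R x" "1 *\<^sub>R x = x"
    by (simp_all add: algebra_simps)
  show "x * y * z = x * (y * z)"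
    by (simp add: algebra_simps)
  show "(x + y) * z = x * z + y * z" "x * (y + z) = x * y + x * z"
    by (simp_all add: algebra_simps)
  show "1 * x = x" "x * 1 = x" "(0 :: quat) \<noteq> 1"
    by simp_all
  show "r *\<^sub>R x * y = r *\<^sub>R (x * y)" "x * r *\<^sub>R y = r *\<^sub>R (x * y)"
    by (simp_all add: algebra_simps)
  show "inverse (0 :: quat) = 0" "x div y = x * inverse y"
    by simp_all
next
  fix x :: quat
  assume "x \<noteq> 0"
  then have "(qRe x)\<^sup>2 + (qI x)\<^sup>2 + (qJ x)\<^sup>2 + (qK x)\<^sup>2 \<noteq> 0"
    by (auto simp: quat_eq_iff zero_quat_def add_nonneg_eq_0_iff)
  then have n: "inverse ((qRe x)\<^sup>2 + (qI x)\<^sup>2 + (qJ x)\<^sup>2 + (qK x)\<^sup>2) *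
      ((qRe x)\<^sup>2 + (qI x)\<^sup>2 + (qJ x)\<^sup>2 + (qK x)\<^sup>2) = 1" (is "?c * ?N = 1")
    by simp
  have "inverse x * x = Quat (?c * ?N) 0 0 0" "x * inverse x = Quat (?c * ?N) 0 0 0"
    unfolding inverse_quat_def times_quat_def scaleR_quat_def quat_eq_iff quat.sel power2_eq_square
    by (safe; algebra)+
  then show "inverse x * x = 1" "x * inverse x = 1"
    by (simp_all only: n one_quat_def)
qed

end

definition qcnj :: "quat \<Rightarrow> quat" where
  "qcnj x = Quat (qRe x) (- qI x) (- qJ x) (- qK x)"

lemma of_real_quat: "of_real r = Quat r 0 0 0"
  by (simp add: of_real_def scaleR_quat_def one_quat_def)

lemma of_real_quat_commute: "of_real r * x = x * (of_real r :: quat)"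
  by (simp add: of_real_quat times_quat_def algebra_simps)

definition qnorm2 :: "quat \<Rightarrow> real" where
  "qnorm2 x = (qRe x)\<^sup>2 + (qI x)\<^sup>2 + (qJ x)\<^sup>2 + (qK x)\<^sup>2"

lemma mult_qcnj: "x * qcnj x = of_real (qnorm2 x)" "qcnj x * x = of_real (qnorm2 x)"
  by (simp_all add: of_real_quat qcnj_def qnorm2_def times_quat_def power2_eq_square)


section \<open>Words\<close>

text \<open>The letters are indexed by a finite type \<open>'n\<close>, so that $n$ is \<open>CARD('n)\<close>.\<close>

datatype 'n letter = Q 'n | Qbar 'n

fun idx :: "'n letter \<Rightarrow> 'n" where
  "idx (Q i) = i"
| "idx (Qbar i) = i"

fun bar :: "'n letter \<Rightarrow> 'n letter" where
  "bar (Q i) = Qbar i"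
| "bar (Qbar i) = Q i"

lemma bar_bar [simp]: "bar (bar x) = x"
  by (cases x) auto

lemma idx_bar [simp]: "idx (bar x) = idx x"
  by (cases x) auto

lemma bar_neq [simp]: "bar x \<noteq> x" "x \<noteq> bar x"
  by (cases x; simp)+

text \<open>
  A normal form is a pair \<open>(\<alpha>, w)\<close> standing for $\prod_i |q_i|^{2\alpha_i} w$ where \<open>w\<close> has no
  factor $q_i \bar q_i$ or $\bar q_i q_i$. It is computed by reading a list of letters from right
  to left. The lemmas \<open>nf_reduced\<close>, \<open>nf_of_reduced\<close> and \<open>nf_factor\<close> below characterize it.
\<close>

definition bump :: "('n \<Rightarrow> nat) \<Rightarrow> ('n \<Rightarrow> nat) \<times> 'n letter list \<Rightarrow> ('n \<Rightarrow> nat) \<times> 'n letter list" where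
  "bump \<beta> a = ((\<lambda>i. \<beta> i + fst a i), snd a)"

definition unit_exp :: "'n \<Rightarrow> 'n \<Rightarrow> nat" where
  "unit_exp i = (\<lambda>j. if j = i then 1 else 0)"

fun push :: "'n letter \<Rightarrow> ('n \<Rightarrow> nat) \<times> 'n letter list \<Rightarrow> ('n \<Rightarrow> nat) \<times> 'n letter list" where
  "push x (\<alpha>, []) = (\<alpha>, [x])"
| "push x (\<alpha>, y # w) = (if y = bar x then bump (unit_exp (idx x)) (\<alpha>, w) else (\<alpha>, x # y # w))"

definition nf :: "'n letter list \<Rightarrow> ('n \<Rightarrow> nat) \<times> 'n letter list" where
  "nf u = foldr push u ((\<lambda>_. 0), [])"

definition reduced :: "'n letter list \<Rightarrow> bool" where
  "reduced w \<longleftrightarrow> (\<nexists>u x v. w = u @ [x, bar x] @ v)"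

lemma reduced_Nil [simp]: "reduced []"
  by (simp add: reduced_def)

lemma reduced_single [simp]: "reduced [x]"
  by (auto simp: reduced_def Cons_eq_append_conv)

lemma reduced_Cons [simp]: "reduced (x # y # w) \<longleftrightarrow> y \<noteq> bar x \<and> reduced (y # w)"
proof
  assume r: "reduced (x # y # w)"
  have "y \<noteq> bar x"
    using r unfolding reduced_def by (metis append_Cons append_Nil)
  moreover have "reduced (y # w)"
    using r unfolding reduced_def by (metis append_Cons)
  ultimately show "y \<noteq> bar x \<and> reduced (y # w)" ..
next
  assume r: "y \<noteq> bar x \<and> reduced (y # w)"
  show "reduced (x # y # w)"
    unfolding reduced_def
  proof clarify
    fix u z v
    assume "x # y # w = u @ [z, bar z] @ v"
    with r show False
      by (cases u) (auto simp: reduced_def)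
  qed
qed

lemma reduced_ConsD: "reduced (x # w) \<Longrightarrow> reduced w"
  by (cases w) auto

lemma bump_bump: "bump \<beta> (bump \<gamma> a) = bump (\<lambda>i. \<beta> i + \<gamma> i) a"
  by (simp add: bump_def add.assoc)

lemma snd_bump [simp]: "snd (bump \<beta> a) = snd a"
  by (simp add: bump_def)

lemma fst_bump [simp]: "fst (bump \<beta> a) i = \<beta> i + fst a i"
  by (simp add: bump_def)

lemma push_bump: "push x (bump \<beta> a) = bump \<beta> (push x a)"
  by (cases "(x, a)" rule: push.cases) (auto simp: bump_def add_ac)

lemma foldr_push_bump: "foldr push u (bump \<beta> a) = bump \<beta> (foldr push u a)"
  by (induction u) (auto simp: push_bump)

lemma reduced_push: "reduced (snd a) \<Longrightarrow> reduced (snd (push x a))"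
  by (cases "(x, a)" rule: push.cases) (auto dest: reduced_ConsD)

lemma reduced_foldr_push: "reduced (snd a) \<Longrightarrow> reduced (snd (foldr push u a))"
  by (induction u) (auto intro: reduced_push)

lemma push_push_bar:
  assumes "reduced (snd a)"
  shows "push x (push (bar x) a) = bump (unit_exp (idx x)) a"
proof -
  obtain \<alpha> w where a: "a = (\<alpha>, w)" by fastforce
  show ?thesis
  proof (cases w)
    case (Cons y v)
    show ?thesis using assms
      by (cases v) (auto simp: a Cons push_bump)
  qed (auto simp: a)
qed

lemma foldr_push_nf:
  assumes "reduced (snd a)"
  shows "foldr push u a = bump (fst (nf u)) (foldr push (snd (nf u)) a)"
proof (induction u)
  case Nil
  show ?case by (simp add: nf_def bump_def)
next
  case (Cons x u)
  obtain \<alpha> w where nu: "nf u = (\<alpha>, w)" by fastforce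
  have nx: "nf (x # u) = push x (\<alpha>, w)" using nu by (simp add: nf_def)
  have IH: "foldr push u a = bump \<alpha> (foldr push w a)" using Cons nu by simp
  show ?case
  proof (cases "\<exists>v. w = bar x # v")
    case True
    then obtain v where w: "w = bar x # v" by blast
    have "push x (push (bar x) (foldr push v a)) = bump (unit_exp (idx x)) (foldr push v a)"
      by (rule push_push_bar) (rule reduced_foldr_push[OF assms])
    then show ?thesis using w by (simp add: nx IH push_bump bump_bump) (simp add: bump_def add_ac)
  next
    case False
    then have "push x (\<alpha>, w) = (\<alpha>, x # w)" by (cases w) auto
    then show ?thesis by (simp add: nx IH push_bump)
  qed
qed

lemma nf_append: "nf (u @ v) = foldr push u (nf v)"
  by (simp add: nf_def)

lemma nf_reduced: "reduced (snd (nf u))"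
  unfolding nf_def by (rule reduced_foldr_push) simp

lemma nf_of_reduced: "reduced u \<Longrightarrow> nf u = ((\<lambda>_. 0), u)"
proof (induction u)
  case (Cons x u)
  then have "nf u = ((\<lambda>_. 0), u)" by (auto dest: reduced_ConsD)
  then have "nf (x # u) = push x ((\<lambda>_. 0), u)" by (simp add: nf_def)
  then show ?case using Cons.prems by (cases u) auto
qed (simp add: nf_def)

lemma nf_factor: "nf (u @ [x, bar x] @ v) = bump (unit_exp (idx x)) (nf (u @ v))"
proof -
  have "nf ([x, bar x] @ v) = bump (unit_exp (idx x)) (nf v)"
    using push_push_bar[OF nf_reduced, of x v] by (simp add: nf_def)
  then show ?thesis
    by (simp only: nf_append[of u] foldr_push_bump)
qed

lemma nf_append_cong:
  assumes "nf u = nf u'" "nf v = nf v'"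
  shows "nf (u @ v) = nf (u' @ v')"
  using foldr_push_nf[OF nf_reduced, of u v] foldr_push_nf[OF nf_reduced, of u' v'] assms
  by (simp add: nf_append)

definition list_star :: "'n letter list \<Rightarrow> 'n letter list" where
  "list_star u = rev (map bar u)"

lemma nf_append': "nf (u @ v) = bump (fst (nf u)) (nf (snd (nf u) @ v))"
  by (simp add: nf_append foldr_push_nf[OF nf_reduced, of u v])

lemma nf_list_star:
  "nf (list_star u) = bump (fst (nf u)) (nf (list_star (snd (nf u))))"
proof (induction u)
  case Nil
  show ?case by (simp add: nf_def bump_def)
next
  case (Cons x u)
  obtain \<alpha> w where nu: "nf u = (\<alpha>, w)" by fastforce
  have nx: "nf (x # u) = push x (\<alpha>, w)" using nu by (simp add: nf_def)
  have IH: "nf (list_star u) = bump \<alpha> (nf (list_star w))" using Cons nu by simp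
  have "nf (list_star (x # u)) = nf (list_star u @ [bar x])"
    by (simp add: list_star_def)
  also have "\<dots> = bump \<alpha> (nf (list_star w @ [bar x]))"
    by (subst (1 2) nf_append') (simp add: IH bump_bump, simp add: bump_def)
  finally have eq: "nf (list_star (x # u)) = bump \<alpha> (nf (list_star w @ [bar x]))" .
  show ?case
  proof (cases "\<exists>v. w = bar x # v")
    case True
    then obtain v where w: "w = bar x # v" by blast
    have "nf (list_star w @ [bar x]) = bump (unit_exp (idx x)) (nf (list_star v))"
      using nf_factor[of "list_star v" x "[]"] by (simp add: w list_star_def)
    then show ?thesis
      unfolding eq nx by (simp add: w bump_bump) (simp add: bump_def add_ac)
  next
    case False
    then have "push x (\<alpha>, w) = (\<alpha>, x # w)" by (cases w) auto
    then show ?thesis unfolding eq nx by (simp add: list_star_def)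
  qed
qed

quotient_type 'n qword = "'n letter list" / "\<lambda>u v. nf u = nf v"
  by (intro equivpI reflpI sympI transpI) auto

text \<open>Concatenation is written additively, as \<^typ>\<open>'n qword \<Rightarrow>\<^sub>0 real\<close> then has the convolution
  product of \<^theory>\<open>HOL-Library.Poly_Mapping\<close>. The empty word is \<open>0\<close>.\<close>

instantiation qword :: (type) monoid_add
begin

lift_definition zero_qword :: "'n qword" is "[]" .

lift_definition plus_qword :: "'n qword \<Rightarrow> 'n qword \<Rightarrow> 'n qword" is "(@)"
  by (rule nf_append_cong)

instance
  by standard (transfer, simp)+

end

lift_definition letter :: "'n letter \<Rightarrow> 'n qword" is "\<lambda>x. [x]" .

lift_definition word_star :: "'n qword \<Rightarrow> 'n qword" is list_star
  subgoal for u v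
    using nf_list_star[of u] nf_list_star[of v] by simp
  done

lemma length_nf: "length u = 2 * sum (fst (nf u)) UNIV + length (snd (nf u))"
  for u :: "'n::finite letter list"
proof (induction u)
  case (Cons x u)
  obtain \<alpha> w where nu: "nf u = (\<alpha>, w)" by fastforce
  have nx: "nf (x # u) = push x (\<alpha>, w)" using nu by (simp add: nf_def)
  show ?case using Cons
    by (cases w) (auto simp: nu nx bump_def sum.distrib unit_exp_def)
qed (simp add: nf_def)

lift_definition wlen :: "'n::finite qword \<Rightarrow> nat" is length
  subgoal for u v
    using length_nf[of u] length_nf[of v] by simp
  done

definition words_le :: "nat \<Rightarrow> 'n::finite qword set" where
  "words_le t = {w. wlen w \<le> t}"

lemma finite_words_le: "finite (words_le t :: 'n::finite qword set)"
proof -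
  have fin: "finite (UNIV :: 'n letter set)"
  proof -
    have "x \<in> range Q \<union> range Qbar" for x :: "'n letter"
      by (cases x) auto
    then have "(UNIV :: 'n letter set) \<subseteq> range Q \<union> range Qbar"
      by blast
    then show ?thesis
      by (rule finite_subset) simp
  qed
  have "words_le t \<subseteq> abs_qword ` {u :: 'n letter list. set u \<subseteq> UNIV \<and> length u \<le> t}"
  proof
    fix w :: "'n qword"
    assume "w \<in> words_le t"
    then show "w \<in> abs_qword ` {u. set u \<subseteq> UNIV \<and> length u \<le> t}"
      by (induction w rule: qword.abs_induct) (auto simp: words_le_def wlen.abs_eq)
  qed
  then show ?thesis
    by (rule finite_subset) (intro finite_imageI finite_lists_length_le fin)
qed

definition cyc_equiv :: "'n qword \<Rightarrow> 'n qword \<Rightarrow> bool" where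
  "cyc_equiv u v \<longleftrightarrow> (\<exists>w1 w2. u = w1 + w2 \<and> v = w2 + w1)"


section \<open>Polynomials\<close>

type_synonym 'n qpoly = "'n qword \<Rightarrow>\<^sub>0 real"

abbreviation rconst :: "real \<Rightarrow> 'n qpoly" where
  "rconst c \<equiv> Poly_Mapping.single 0 c"

abbreviation wmono :: "'n qword \<Rightarrow> 'n qpoly" where
  "wmono w \<equiv> Poly_Mapping.single w 1"

abbreviation qvar :: "'n \<Rightarrow> 'n qpoly" where
  "qvar i \<equiv> wmono (letter (Q i))"

abbreviation qvarbar :: "'n \<Rightarrow> 'n qpoly" where
  "qvarbar i \<equiv> wmono (letter (Qbar i))"

definition pstar :: "'n qpoly \<Rightarrow> 'n qpoly" where
  "pstar p = (\<Sum>w\<in>Poly_Mapping.keys p.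
     Poly_Mapping.single (word_star w) (Poly_Mapping.lookup p w))"

definition pdeg :: "'n::finite qpoly \<Rightarrow> nat" where
  "pdeg p = (if p = 0 then 0 else Max (wlen ` Poly_Mapping.keys p))"

definition Symp :: "'n qpoly set" where
  "Symp = {p. pstar p = p}"

definition commutator :: "'n qpoly \<Rightarrow> 'n qpoly \<Rightarrow> 'n qpoly" where
  "commutator a b = a * b - b * a"

fun letter_val :: "('n \<Rightarrow> quat) \<Rightarrow> 'n letter \<Rightarrow> quat" where
  "letter_val a (Q i) = a i"
| "letter_val a (Qbar i) = qcnj (a i)"

lemma letter_val_bar:
  "letter_val a x * letter_val a (bar x) = of_real (qnorm2 (a (idx x)))"
  by (cases x) (auto simp: mult_qcnj)

lemma prod_list_letter_val_nf:
  "prod_list (map (letter_val a) u) =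
     of_real (\<Prod>i\<in>UNIV. qnorm2 (a i) ^ fst (nf u) i) * prod_list (map (letter_val a) (snd (nf u)))"
  for u :: "'n::finite letter list"
proof (induction u)
  case (Cons x u)
  obtain \<alpha> w where nu: "nf u = (\<alpha>, w)" by fastforce
  have nx: "nf (x # u) = push x (\<alpha>, w)" using nu by (simp add: nf_def)
  let ?c = "\<Prod>i\<in>UNIV. qnorm2 (a i) ^ \<alpha> i"
  let ?P = "\<lambda>w. prod_list (map (letter_val a) w)"
  have eq: "?P (x # u) = of_real ?c * (letter_val a x * ?P w)"
  proof -
    have "?P u = of_real ?c * ?P w" using Cons nu by simp
    then have "?P (x # u) = letter_val a x * of_real ?c * ?P w"
      by (simp only: list.map prod_list.Cons mult.assoc)
    also have "letter_val a x * of_real ?c = of_real ?c * letter_val a x"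
      by (rule of_real_quat_commute[symmetric])
    finally show ?thesis by (simp only: mult.assoc)
  qed
  show ?case
  proof (cases "\<exists>v. w = bar x # v")
    case True
    then obtain v where w: "w = bar x # v" by blast
    have "(\<Prod>i\<in>UNIV. qnorm2 (a i) ^ unit_exp (idx x) i) =
        (\<Prod>i\<in>UNIV. if i = idx x then qnorm2 (a i) else 1)"
      by (intro prod.cong) (auto simp: unit_exp_def)
    then have c: "(\<Prod>i\<in>UNIV. qnorm2 (a i) ^ (unit_exp (idx x) i + \<alpha> i)) =
        ?c * qnorm2 (a (idx x))"
      by (simp add: power_add prod.distrib)
    have "letter_val a x * ?P w = of_real (qnorm2 (a (idx x))) * ?P v"
      by (simp only: w list.map prod_list.Cons mult.assoc[symmetric] letter_val_bar)
    then have "?P (x # u) = of_real (?c * qnorm2 (a (idx x))) * ?P v"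
      by (simp only: eq of_real_mult mult.assoc)
    moreover have "nf (x # u) = ((\<lambda>i. unit_exp (idx x) i + \<alpha> i), v)"
      by (simp add: nx w bump_def)
    ultimately show ?thesis
      by (simp only: c fst_conv snd_conv)
  next
    case False
    then have "push x (\<alpha>, w) = (\<alpha>, x # w)" by (cases w) auto
    then have "nf (x # u) = (\<alpha>, x # w)"
      using nx by simp
    then show ?thesis
      unfolding eq by (simp only: fst_conv snd_conv list.map prod_list.Cons)
  qed
qed (simp add: nf_def)

lift_definition word_eval :: "('n::finite \<Rightarrow> quat) \<Rightarrow> 'n qword \<Rightarrow> quat"
  is "\<lambda>a u. prod_list (map (letter_val a) u)"
  subgoal for a u v
    using prod_list_letter_val_nf[of a u] prod_list_letter_val_nf[of a v] by simp
  done

definition peval :: "('n::finite \<Rightarrow> quat) \<Rightarrow> 'n qpoly \<Rightarrow> quat" where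
  "peval a p = (\<Sum>w\<in>Poly_Mapping.keys p. Poly_Mapping.lookup p w *\<^sub>R word_eval a w)"

definition vanishing_ideal :: "'n::finite qpoly set" where
  "vanishing_ideal = {p. \<forall>a. peval a p = 0}"


section \<open>The optimization problem\<close>

definition feasible ::
    "nat \<Rightarrow> (nat \<Rightarrow> 'n::finite qpoly) \<Rightarrow> nat \<Rightarrow> (nat \<Rightarrow> 'n qpoly) \<Rightarrow> ('n \<Rightarrow> quat) set" where
  "feasible m g l h =
     {a. (\<forall>i\<in>{1..m}. peval a (g i) \<in> \<real>\<^sub>\<ge>\<^sub>0) \<and> (\<forall>j\<in>{1..l}. peval a (h j) = 0)}"

text \<open>For symmetric \<open>f\<close> the value \<open>peval a f\<close> is its own conjugate, hence equal to its real part.\<close>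

definition f_min ::
    "'n::finite qpoly \<Rightarrow> nat \<Rightarrow> (nat \<Rightarrow> 'n qpoly) \<Rightarrow> nat \<Rightarrow> (nat \<Rightarrow> 'n qpoly) \<Rightarrow> ereal" where
  "f_min f m g l h = (INF a\<in>feasible m g l h. ereal (qRe (peval a f)))"


section \<open>Sums of squares and quadratic modules\<close>

definition SOS :: "'n qpoly set" where
  "SOS = {\<Sum>s<N. pstar (p s) * p s | (N :: nat) p. True}"

definition SOS_deg :: "nat \<Rightarrow> 'n::finite qpoly set" where
  "SOS_deg d = SOS \<inter> {p. pdeg p \<le> 2 * d}"

definition qm_expr ::
    "nat \<Rightarrow> (nat \<Rightarrow> 'n qpoly) \<Rightarrow> nat \<Rightarrow> (nat \<Rightarrow> 'n qpoly) \<Rightarrow> (nat \<Rightarrow> 'n qpoly) \<Rightarrow>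
     (nat \<Rightarrow> nat) \<Rightarrow> (nat \<Rightarrow> nat \<Rightarrow> 'n qpoly) \<Rightarrow> (nat \<Rightarrow> nat \<Rightarrow> 'n qpoly) \<Rightarrow> 'n qpoly" where
  "qm_expr m g l h \<sigma> N \<tau> \<nu> =
     \<sigma> 0 + rconst (1/2) * (\<Sum>i=1..m. \<sigma> i * g i + g i * \<sigma> i)
     + (\<Sum>j=1..l. \<Sum>\<alpha><N j. \<tau> j \<alpha> * h j * \<nu> j \<alpha>
          + pstar (\<nu> j \<alpha>) * pstar (h j) * pstar (\<tau> j \<alpha>))"

definition quad_module ::
    "nat \<Rightarrow> (nat \<Rightarrow> 'n qpoly) \<Rightarrow> nat \<Rightarrow> (nat \<Rightarrow> 'n qpoly) \<Rightarrow> 'n qpoly set" where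
  "quad_module m g l h = {qm_expr m g l h \<sigma> N \<tau> \<nu> | \<sigma> N \<tau> \<nu>. \<forall>i\<in>{0..m}. \<sigma> i \<in> SOS}"

definition archimedean_qm ::
    "nat \<Rightarrow> (nat \<Rightarrow> 'n::finite qpoly) \<Rightarrow> nat \<Rightarrow> (nat \<Rightarrow> 'n qpoly) \<Rightarrow> bool" where
  "archimedean_qm m g l h \<longleftrightarrow>
     (\<exists>R>0. rconst R - (\<Sum>i\<in>UNIV. qvar i * qvarbar i) \<in> quad_module m g l h)"

definition half_deg :: "'n::finite qpoly \<Rightarrow> nat" where
  "half_deg p = nat \<lceil>real (pdeg p) / 2\<rceil>"

text \<open>The relaxation orders considered are those in \<open>admissible\<close>; the subtractions below are then
  not truncated.\<close>

definition admissible ::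
    "'n::finite qpoly \<Rightarrow> nat \<Rightarrow> (nat \<Rightarrow> 'n qpoly) \<Rightarrow> nat \<Rightarrow> (nat \<Rightarrow> 'n qpoly) \<Rightarrow> nat set" where
  "admissible f m g l h =
     {d. pdeg f \<le> 2 * d \<and> (\<forall>i\<in>{1..m}. pdeg (g i) \<le> 2 * d) \<and> (\<forall>j\<in>{1..l}. pdeg (h j) \<le> 2 * d)}"

definition quad_module_deg ::
    "nat \<Rightarrow> (nat \<Rightarrow> 'n::finite qpoly) \<Rightarrow> nat \<Rightarrow> (nat \<Rightarrow> 'n qpoly) \<Rightarrow> nat \<Rightarrow> 'n qpoly set" where
  "quad_module_deg m g l h d = {qm_expr m g l h \<sigma> N \<tau> \<nu> | \<sigma> N \<tau> \<nu>.
     \<sigma> 0 \<in> SOS_deg d \<and>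
     (\<forall>i\<in>{1..m}. \<sigma> i \<in> SOS_deg (d - half_deg (g i))) \<and>
     (\<forall>j\<in>{1..l}. \<forall>\<alpha><N j. pdeg (\<tau> j \<alpha>) + pdeg (\<nu> j \<alpha>) \<le> 2 * d - pdeg (h j))}"


section \<open>The relaxations\<close>

definition riesz :: "('n qword \<Rightarrow> real) \<Rightarrow> 'n qpoly \<Rightarrow> real" where
  "riesz y p = (\<Sum>w\<in>Poly_Mapping.keys p. Poly_Mapping.lookup p w * y w)"

definition psd_on :: "'a set \<Rightarrow> ('a \<Rightarrow> 'a \<Rightarrow> real) \<Rightarrow> bool" where
  "psd_on S M \<longleftrightarrow> (\<forall>u\<in>S. \<forall>v\<in>S. M u v = M v u) \<and>
     (\<forall>x. (\<Sum>u\<in>S. \<Sum>v\<in>S. x u * M u v * x v) \<ge> 0)"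

definition moment_matrix :: "('n qword \<Rightarrow> real) \<Rightarrow> 'n qword \<Rightarrow> 'n qword \<Rightarrow> real" where
  "moment_matrix y u v = riesz y (wmono (word_star u) * wmono v)"

definition localizing_matrix ::
    "'n qpoly \<Rightarrow> ('n qword \<Rightarrow> real) \<Rightarrow> 'n qword \<Rightarrow> 'n qword \<Rightarrow> real" where
  "localizing_matrix g y u v = riesz y (wmono (word_star u) * g * wmono v)"

text \<open>A family $(y_w)$ indexed by the words of length at most $2d$ is a total function \<open>y\<close> whose
  values at longer words are not used.\<close>

definition moment_feasible ::
    "nat \<Rightarrow> (nat \<Rightarrow> 'n::finite qpoly) \<Rightarrow> nat \<Rightarrow> (nat \<Rightarrow> 'n qpoly) \<Rightarrow> nat \<Rightarrow>
     ('n qword \<Rightarrow> real) set" where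
  "moment_feasible m g l h d = {y.
     y 0 = 1 \<and>
     (\<forall>w\<in>words_le (2 * d). y w = y (word_star w)) \<and>
     (\<forall>u\<in>words_le (2 * d). \<forall>v\<in>words_le (2 * d). cyc_equiv u v \<longrightarrow> y u = y v) \<and>
     psd_on (words_le d) (moment_matrix y) \<and>
     (\<forall>i\<in>{1..m}. psd_on (words_le (d - half_deg (g i))) (localizing_matrix (g i) y)) \<and>
     (\<forall>j\<in>{1..l}. \<forall>u v. wlen u + wlen v \<le> 2 * d - pdeg (h j) \<longrightarrow>
        riesz y (wmono u * h j * wmono v) = 0) \<and>
     (\<forall>i u v w. wlen u + wlen v + wlen w + 1 \<le> 2 * d \<longrightarrow>
        riesz y (wmono u * commutator (wmono w + wmono (word_star w)) (qvar i) * wmono v) = 0)}"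

definition moment_value ::
    "'n::finite qpoly \<Rightarrow> nat \<Rightarrow> (nat \<Rightarrow> 'n qpoly) \<Rightarrow> nat \<Rightarrow> (nat \<Rightarrow> 'n qpoly) \<Rightarrow> nat \<Rightarrow> ereal" where
  "moment_value f m g l h d = (INF y\<in>moment_feasible m g l h d. ereal (riesz y f))"

definition qsos_value ::
    "'n::finite qpoly \<Rightarrow> nat \<Rightarrow> (nat \<Rightarrow> 'n qpoly) \<Rightarrow> nat \<Rightarrow> (nat \<Rightarrow> 'n qpoly) \<Rightarrow> nat \<Rightarrow> ereal" where
  "qsos_value f m g l h d = Sup (ereal ` {c.
     \<exists>p \<in> quad_module_deg m g l h d. \<exists>r \<in> vanishing_ideal \<inter> Symp \<inter> {r. pdeg r \<le> 2 * d}.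
       f - rconst c = p + r})"

end

theory Submission
  imports Defs
begin

text \<open>
  Both relaxations are governed by the quotient of the free algebra by the ideal generated by the
  commutators $[w + w^*, x]$ of traces with letters: in this quotient every $a + a^*$ is central, so
  the hermitian elements form a commutative ring, and the quadratic module becomes an archimedean
  module over it. Jacobi's version of the Kadison--Dubois theorem then puts a hermitian element in the
  module as soon as all characters of the hermitian part that are nonnegative on the module are
  positive there. Such a character $\varphi$ makes $\varphi(p^* p)$ a multiplicative seminorm,
  and dividing by its null ideal leaves a real division algebra in which $p^* p$ is a positive scalar;
  by Frobenius' argument it embeds into the quaternions, so $\varphi$ is evaluation at a point of
  the feasible set. For $c < f_{\min}$ this represents $f - c$ modulo the ideal. The ideal vanishes
  at all points and is annihilated by moment functionals of large order, whence both lower bounds.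
\<close>

section \<open>Quadratic modules in star algebras with central traces\<close>

text \<open>The choice of ideal shapes everything. Moment functionals are only required to kill
  trace commutators, so a certificate modulo the full vanishing ideal need not bound
  \<open>moment_value\<close>; the smaller ideal generated by these commutators serves both
  relaxations. The price is that positivity in the quotient cannot be read off from points:
  characters of its hermitian part must first be shown to be point evaluations, and this is where
  Frobenius enters. Commutative arguments survive because conjugating a hermitian element by p is
  multiplication by the central element \<open>star p * p\<close>, even though the elements p do not
  commute. No duality between the relaxations and no compactness of moment sequences is used. One
  certificate for f - c, of uncontrolled degree, bounds both values from below for all large d.
  Degree bookkeeping is therefore confined to statements holding eventually in d, with a threshold
  that depends on the certificate but not on the functional.\<close>

locale central_trace_algebra =
  fixes star :: "'a::real_algebra_1 \<Rightarrow> 'a"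
  assumes star_star [simp]: "star (star a) = a"
    and star_add: "star (a + b) = star a + star b"
    and star_mult: "star (a * b) = star b * star a"
    and star_scaleR: "star (r *\<^sub>R a) = r *\<^sub>R star a"
    and add_star_central: "(a + star a) * b = b * (a + star a)"
begin

definition herm :: "'a set" where
  "herm = {a. star a = a}"

lemma star_one [simp]: "star 1 = 1"
  by (metis mult.right_neutral star_mult star_star)

lemma star_zero [simp]: "star 0 = 0"
  using star_scaleR[of 0 0] by simp

lemma star_minus: "star (- a) = - star a"
  using star_scaleR[of "-1" a] by simp

lemma star_diff: "star (a - b) = star a - star b"
  using star_add[of a "- b"] by (simp add: star_minus)

lemma star_of_real [simp]: "star (of_real r) = of_real r"
  by (simp add: of_real_def star_scaleR)

lemmas star_simps = star_add star_mult star_scaleR star_minus star_diff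

lemma herm_add: "a \<in> herm \<Longrightarrow> b \<in> herm \<Longrightarrow> a + b \<in> herm"
  and herm_diff: "a \<in> herm \<Longrightarrow> b \<in> herm \<Longrightarrow> a - b \<in> herm"
  and herm_minus: "a \<in> herm \<Longrightarrow> - a \<in> herm"
  and herm_scaleR: "a \<in> herm \<Longrightarrow> r *\<^sub>R a \<in> herm"
  and herm_of_real: "of_real r \<in> herm"
  and herm_zero: "0 \<in> herm"
  and herm_one: "1 \<in> herm"
  and herm_square: "star p * p \<in> herm"
  and herm_conj: "a \<in> herm \<Longrightarrow> star p * a * p \<in> herm"
  by (simp_all add: herm_def star_simps mult.assoc)

text \<open>For hermitian a the central trace \<open>a + star a\<close> is 2a, and 2 can be
  cancelled over the reals.\<close>

lemma herm_central:
  assumes "a \<in> herm"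
  shows "a * b = b * a"
proof -
  have "2 *\<^sub>R (a * b) = 2 *\<^sub>R (b * a)"
    using add_star_central[of a b] assms by (simp add: herm_def scaleR_2 distrib_left distrib_right)
  then show ?thesis by simp
qed

lemma herm_mult: "a \<in> herm \<Longrightarrow> b \<in> herm \<Longrightarrow> a * b \<in> herm"
  using herm_central[of a b] by (simp add: herm_def star_mult)

lemmas herm_intros = herm_add herm_diff herm_minus herm_scaleR herm_of_real herm_zero herm_one
  herm_square herm_conj herm_mult

text \<open>Every element commutes with its own trace \<open>a + star a\<close>; cancelling
  \<open>a * a\<close> leaves normality.\<close>

lemma mult_star_commute: "a * star a = star a * a"
  using add_star_central[of a a] by (simp add: distrib_left distrib_right)

lemma conj_herm: "a \<in> herm \<Longrightarrow> star p * a * p = star p * p * a"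
  using herm_central[of a p] by (simp add: mult.assoc)

section \<open>Sums of hermitian squares and the quadratic modules over them\<close>

text \<open>These are the coefficients that a quadratic module admits: it is closed under
  conjugation, and by \<open>conj_herm\<close> conjugation multiplies by
  \<open>star p * p\<close>.\<close>

inductive_set hsums :: "'a set" where
  zero: "0 \<in> hsums"
| add: "t \<in> hsums \<Longrightarrow> t + star p * p \<in> hsums"

lemma hsums_herm: "t \<in> hsums \<Longrightarrow> t \<in> herm"
  by (induction rule: hsums.induct) (auto intro: herm_intros)

lemma hsums_square: "star p * p \<in> hsums"
  using hsums.add[OF hsums.zero] by simp

lemma hsums_square_herm: "a \<in> herm \<Longrightarrow> a * a \<in> hsums"
  using hsums_square[of a] by (simp add: herm_def)

lemma hsums_add: "t \<in> hsums \<Longrightarrow> s \<in> hsums \<Longrightarrow> s + t \<in> hsums"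
  by (induction rule: hsums.induct) (auto intro: hsums.add simp: add.assoc[symmetric])

lemma hsums_conj: "t \<in> hsums \<Longrightarrow> star q * t * q \<in> hsums"
proof (induction rule: hsums.induct)
  case (add t p)
  have "star q * (t + star p * p) * q = star q * t * q + star (p * q) * (p * q)"
    by (simp add: algebra_simps star_mult)
  then show ?case using hsums.add[OF add.IH] by simp
qed (simp add: hsums.zero)

definition qmodule :: "'a set \<Rightarrow> bool" where
  "qmodule N \<longleftrightarrow> N \<subseteq> herm \<and> 1 \<in> N \<and> (\<forall>x\<in>N. \<forall>y\<in>N. x + y \<in> N) \<and> (\<forall>x\<in>N. \<forall>p. star p * x * p \<in> N)"

definition archimedean :: "'a set \<Rightarrow> bool" where
  "archimedean N \<longleftrightarrow> (\<forall>a\<in>herm. \<exists>k. of_real k - a \<in> N)"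

definition character :: "('a \<Rightarrow> real) \<Rightarrow> bool" where
  "character \<phi> \<longleftrightarrow> (\<forall>a\<in>herm. \<forall>b\<in>herm. \<phi> (a + b) = \<phi> a + \<phi> b \<and> \<phi> (a * b) = \<phi> a * \<phi> b) \<and>
     (\<forall>r. \<phi> (of_real r) = r)"

context
  fixes N assumes N: "qmodule N"
begin

lemma qmodule_herm: "x \<in> N \<Longrightarrow> x \<in> herm"
  and qmodule_one: "1 \<in> N"
  and qmodule_add: "x \<in> N \<Longrightarrow> y \<in> N \<Longrightarrow> x + y \<in> N"
  and qmodule_conj: "x \<in> N \<Longrightarrow> star p * x * p \<in> N"
  using N by (auto simp: qmodule_def)

lemma qmodule_square: "star p * p \<in> N"
  using qmodule_conj[OF qmodule_one, of p] by simp

lemma qmodule_zero: "0 \<in> N"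
  using qmodule_square[of 0] by simp

lemma qmodule_scaleR:
  assumes "x \<in> N" "r \<ge> 0"
  shows "r *\<^sub>R x \<in> N"
  using qmodule_conj[OF assms(1), of "of_real (sqrt r)"] assms(2)
  by (simp add: of_real_def star_scaleR)

lemma qmodule_of_real: "r \<ge> 0 \<Longrightarrow> of_real r \<in> N"
  using qmodule_scaleR[OF qmodule_one, of r] by (simp add: of_real_def)

lemma qmodule_hsums_mult: "t \<in> hsums \<Longrightarrow> x \<in> N \<Longrightarrow> t * x \<in> N"
proof (induction rule: hsums.induct)
  case (add t p)
  have "(t + star p * p) * x = t * x + star p * x * p"
    using conj_herm[of x p] qmodule_herm[OF add.prems] by (simp add: distrib_right)
  then show ?case using add qmodule_add qmodule_conj by simp
qed (simp add: qmodule_zero)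

lemma qmodule_hsums: "t \<in> hsums \<Longrightarrow> t \<in> N"
  using qmodule_hsums_mult[OF _ qmodule_one] by simp

text \<open>A single coefficient t on one side of a suffices because a is central: conjugation by p
  turns \<open>t * a\<close> into \<open>(star p * t * p) * a\<close>.\<close>

lemma qmodule_adjoin:
  assumes a: "a \<in> herm"
  shows "qmodule {x + t * a |x t. x \<in> N \<and> t \<in> hsums}" (is "qmodule ?N'")
  unfolding qmodule_def
proof (intro conjI ballI allI subsetI)
  show "y \<in> herm" if "y \<in> ?N'" for y
    using that a by (auto intro!: herm_intros dest: qmodule_herm hsums_herm)
  show "1 \<in> ?N'"
    using qmodule_one hsums.zero by force
next
  fix y z assume "y \<in> ?N'" "z \<in> ?N'"
  then obtain u s v t where "y = u + s * a" "z = v + t * a"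
    and uv: "u \<in> N" "v \<in> N" and st: "s \<in> hsums" "t \<in> hsums" by blast
  then have "y + z = (u + v) + (s + t) * a" by (simp add: algebra_simps)
  then show "y + z \<in> ?N'" using qmodule_add[OF uv] hsums_add[OF st(2,1)] by blast
next
  fix y p assume "y \<in> ?N'"
  then obtain u s where y: "y = u + s * a" and u: "u \<in> N" and s: "s \<in> hsums" by blast
  have "star p * y * p = star p * u * p + (star p * s * p) * a"
    using herm_central[OF a, of p] by (simp add: y algebra_simps)
  then show "star p * y * p \<in> ?N'" using qmodule_conj[OF u] hsums_conj[OF s] by blast
qed

lemma qmodule_adjoin_sup: "N \<subseteq> {x + t * a |x t. x \<in> N \<and> t \<in> hsums}"
  using hsums.zero by force

lemma qmodule_adjoin_mem: "a \<in> {x + t * a |x t. x \<in> N \<and> t \<in> hsums}"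
  using qmodule_zero hsums_square[of 1] by force

end

section \<open>Maximal proper modules and the characters they define\<close>

lemma qmodule_maximal_exists:
  assumes "qmodule N0" "- 1 \<notin> N0"
  obtains N where "qmodule N" "N0 \<subseteq> N" "- 1 \<notin> N"
    "\<And>N'. qmodule N' \<Longrightarrow> N \<subseteq> N' \<Longrightarrow> - 1 \<notin> N' \<Longrightarrow> N' = N"
proof -
  let ?A = "{N. qmodule N \<and> N0 \<subseteq> N \<and> - 1 \<notin> N}"
  have "\<exists>M\<in>?A. \<forall>X\<in>?A. M \<subseteq> X \<longrightarrow> X = M"
  proof (rule subset_Zorn_nonempty)
    show "?A \<noteq> {}" using assms by blast
    fix C assume C: "C \<noteq> {}" "subset.chain ?A C"
    have mem: "\<And>X. X \<in> C \<Longrightarrow> qmodule X \<and> N0 \<subseteq> X \<and> - 1 \<notin> X"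
      and tot: "\<And>X Y. X \<in> C \<Longrightarrow> Y \<in> C \<Longrightarrow> X \<subseteq> Y \<or> Y \<subseteq> X"
      using C(2) by (auto simp: subset_chain_def)
    have "qmodule (\<Union>C)"
      unfolding qmodule_def
    proof (intro conjI ballI allI)
      show "\<Union>C \<subseteq> herm" using mem unfolding qmodule_def by blast
      show "1 \<in> \<Union>C" using mem C(1) qmodule_one by blast
      show "star p * x * p \<in> \<Union>C" if "x \<in> \<Union>C" for x p
        using that mem qmodule_conj by blast
      show "x + y \<in> \<Union>C" if xy: "x \<in> \<Union>C" "y \<in> \<Union>C" for x y
      proof -
        obtain X Y where XY: "X \<in> C" "Y \<in> C" "x \<in> X" "y \<in> Y" using xy by blast
        then consider "x \<in> Y" | "y \<in> X" using tot[OF XY(1,2)] by blast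
        then show ?thesis using XY mem qmodule_add by (cases; blast)
      qed
    qed
    then show "\<Union>C \<in> ?A" using mem C(1) by blast
  qed
  then show ?thesis
  proof (elim bexE)
    fix M assume M: "M \<in> ?A" "\<forall>X\<in>?A. M \<subseteq> X \<longrightarrow> X = M"
    show ?thesis
    proof (rule that[of M])
      fix N' assume N': "qmodule N'" "M \<subseteq> N'" "- 1 \<notin> N'"
      have "N0 \<subseteq> N'" using M(1) N'(2) by (auto del: subsetI intro: order_trans)
      then show "N' = M" using bspec[OF M(2), of N'] N' by simp
    qed (use M(1) in auto)
  qed
qed

context
  fixes N assumes N: "qmodule N" and arch: "archimedean N" and proper: "- 1 \<notin> N"
    and maximal: "\<And>N'. qmodule N' \<Longrightarrow> N \<subseteq> N' \<Longrightarrow> - 1 \<notin> N' \<Longrightarrow> N' = N"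
begin

text \<open>The support (elements lying in N together with their negatives) is an ideal of the
  hermitian ring: 4a is the difference of the squares of a + 1 and a - 1, the first square
  multiplies u and the second multiplies -u.\<close>

lemma support_mult:
  assumes a: "a \<in> herm" and u: "u \<in> N" "- u \<in> N"
  shows "a * u \<in> N"
proof -
  let ?s = "(1/4) *\<^sub>R ((a + 1) * (a + 1)) * u" and ?t = "(1/4) *\<^sub>R ((a - 1) * (a - 1)) * - u"
  have h: "a + 1 \<in> herm" "a - 1 \<in> herm" using a by (auto intro: herm_intros)
  have "?s \<in> N" "?t \<in> N"
    using qmodule_scaleR[OF N qmodule_hsums_mult[OF N hsums_square_herm[OF h(1)] u(1)], of "1/4"]
      qmodule_scaleR[OF N qmodule_hsums_mult[OF N hsums_square_herm[OF h(2)] u(2)], of "1/4"] by simp_all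
  moreover have "?s + ?t = (1/4) *\<^sub>R (4 *\<^sub>R (a * u))"
    unfolding scaleR_add_right[symmetric] mult_scaleR_left
    by (simp add: algebra_simps) (simp flip: scaleR_left_distrib)
  ultimately show ?thesis using qmodule_add[OF N] by fastforce
qed

text \<open>If both signs fail, maximality puts -1 into the modules obtained by adjoining a and -a.
  Eliminating a from the two representations of -1 shows that t lies in the support, and then
  \<open>x + t * a\<close> is in N, although it equals -1.\<close>

lemma maximal_total:
  assumes a: "a \<in> herm"
  shows "a \<in> N \<or> - a \<in> N"
proof (rule ccontr)
  assume "\<not> ?thesis"
  then have na: "a \<notin> N" "- a \<notin> N" by auto
  have ex: "\<exists>x t. x \<in> N \<and> t \<in> hsums \<and> x + t * b = - 1" if b: "b \<in> herm" "b \<notin> N" for b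
  proof (rule ccontr)
    assume "\<not> ?thesis"
    then have "- 1 \<notin> {x + t * b |x t. x \<in> N \<and> t \<in> hsums}" by (smt (verit) mem_Collect_eq)
    from maximal[OF qmodule_adjoin[OF N b(1)] qmodule_adjoin_sup[OF N] this] show False
      using qmodule_adjoin_mem[OF N, of b] b(2) by simp
  qed
  obtain x t where xt: "x \<in> N" "t \<in> hsums" "x + t * a = - 1" using ex a na(1) by blast
  obtain y s where ys: "y \<in> N" "s \<in> hsums" "y + s * (- a) = - 1"
    using ex herm_minus[OF a] na(2) by blast
  have x: "x = - 1 - t * a" using xt(3) by (simp add: algebra_simps eq_neg_iff_add_eq_0)
  have y: "y = s * a - 1" using ys(3) by (simp add: algebra_simps)
  have st: "s * t = t * s" using herm_central[OF hsums_herm[OF xt(2)], of s] by simp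
  \<comment> \<open>The weights s and t cancel the terms in a, and the extra s absorbs the constant
    coming from \<open>s * x\<close>.\<close>
  have "s * x + t * y + s = - t"
    unfolding x y by (simp add: algebra_simps) (simp add: st mult.assoc[symmetric])
  moreover have "s * x + t * y + s \<in> N"
    by (intro qmodule_add[OF N] qmodule_hsums_mult[OF N] qmodule_hsums[OF N] xt ys)
  ultimately have "- t \<in> N" by simp
  then have "a * t \<in> N" using support_mult[OF a] qmodule_hsums[OF N xt(2)] by blast
  then have "t * a \<in> N" using herm_central[OF a, of t] by simp
  then have "x + t * a \<in> N" using qmodule_add[OF N] xt(1) by blast
  then show False using xt(3) proper by simp
qed

lemma hsums_bounded:
  assumes "t \<in> hsums"
  obtains k where "k > 0" "of_real k - t \<in> N"
proof -
  obtain k where k: "of_real k - t \<in> N"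
    using arch hsums_herm[OF assms] unfolding archimedean_def by blast
  \<comment> \<open>Raising k to at least 1 makes it positive, so that \<open>maximal_closed\<close>
    can divide by it.\<close>
  have "of_real (max k 1) - t = (of_real k - t) + of_real (max k 1 - k)" by simp
  also have "\<dots> \<in> N" by (intro qmodule_add[OF N] k qmodule_of_real[OF N]) simp
  finally show thesis using that[of "max k 1"] by simp
qed

text \<open>The closure of N under this limit is again a quadratic module without -1, so maximality
  makes it equal to N. The archimedean property enters in its closure under conjugation.\<close>

lemma maximal_closed:
  assumes a: "a \<in> herm" and eps: "\<And>e. e > 0 \<Longrightarrow> a + of_real e \<in> N"
  shows "a \<in> N"
proof -
  let ?N' = "{a \<in> herm. \<forall>e>0. a + of_real e \<in> N}"
  have "qmodule ?N'"
    unfolding qmodule_def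
  proof (intro conjI ballI allI)
    show "1 \<in> ?N'" using qmodule_add[OF N qmodule_one[OF N] qmodule_of_real[OF N]] herm_one by simp
  next
    fix x y assume xy: "x \<in> ?N'" "y \<in> ?N'"
    have "x + y + of_real e \<in> N" if "e > 0" for e
    proof -
      have "(x + of_real (e/2)) + (y + of_real (e/2)) \<in> N"
        using xy that by (intro qmodule_add[OF N, of "x + _" "y + _"]) auto
      moreover have "of_real e = of_real (e/2) + (of_real (e/2) :: 'a)"
        by (simp flip: of_real_add)
      ultimately show ?thesis by (simp only: add_ac)
    qed
    then show "x + y \<in> ?N'" using xy herm_add by simp
  next
    fix x p assume x: "x \<in> ?N'"
    obtain k where k: "k > 0" "of_real k - star p * p \<in> N"
      using hsums_bounded hsums_square by blast
    have "star p * x * p + of_real e \<in> N" if "e > 0" for e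
    proof -
      have "of_real (e/k) * of_real k = (of_real e :: 'a)" using k by (simp flip: of_real_mult)
      \<comment> \<open>Of the slack e only e/k is placed inside the conjugation; the resulting
        error \<open>(e/k) *\<^sub>R (star p * p)\<close> is at most e by the choice of k.\<close>
      then have "star p * x * p + of_real e
          = star p * (x + of_real (e/k)) * p + (e/k) *\<^sub>R (of_real k - star p * p)"
        by (simp add: scaleR_conv_of_real algebra_simps) (simp add: of_real_def)
      moreover have "e / k > 0" using that k by simp
      ultimately show ?thesis
        using qmodule_add[OF N] qmodule_conj[OF N] qmodule_scaleR[OF N k(2), of "e/k"] x by simp
    qed
    then show "star p * x * p \<in> ?N'" using x herm_conj by simp
  qed auto
  moreover have "N \<subseteq> ?N'"
    using qmodule_herm[OF N] qmodule_add[OF N] qmodule_of_real[OF N] by auto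
  moreover have "- 1 \<notin> ?N'"
  proof
    assume "- 1 \<in> ?N'"
    \<comment> \<open>Any e below 1 would serve: it leaves a negative constant in N, which rescales
      to -1.\<close>
    then have "- 1 + of_real (1/2) \<in> N" by (auto dest: spec[of _ "1/2"])
    then have "2 *\<^sub>R (- 1 + of_real (1/2)) \<in> N" using qmodule_scaleR[OF N] by fastforce
    moreover have "2 *\<^sub>R (- 1 + of_real (1/2)) = (- 1 :: 'a)"
      by (simp add: of_real_def scaleR_right_diff_distrib scaleR_2)
    ultimately show False using proper by simp
  qed
  ultimately show ?thesis using maximal a eps by blast
qed

text \<open>A Dedekind cut: r is the supremum of the reals below a in the order given by N.
  Closedness puts a - r in N. No r + e lies below a, so totality gives r + e - a in N, and
  closedness again removes e.\<close>

lemma scalar_part_exists: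
  assumes a: "a \<in> herm"
  shows "\<exists>r. a - of_real r \<in> N \<and> of_real r - a \<in> N"
proof -
  let ?S = "{r. a - of_real r \<in> N}"
  obtain k where k: "of_real k - - a \<in> N"
    using arch herm_minus[OF a] unfolding archimedean_def by blast
  then have ne: "- k \<in> ?S" by (simp add: add.commute)
  obtain b where b: "of_real b - a \<in> N" using arch a unfolding archimedean_def by blast
  have "r \<le> b" if "r \<in> ?S" for r
  proof (rule ccontr)
    assume "\<not> r \<le> b"
    moreover have "of_real (b - r) \<in> N"
      using qmodule_add[OF N b, of "a - of_real r"] that by simp
    ultimately have "(1 / (r - b)) *\<^sub>R of_real (b - r) \<in> N" using qmodule_scaleR[OF N] by simp
    moreover have "(1 / (r - b)) *\<^sub>R of_real (b - r) = (- 1 :: 'a)"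
    proof -
      have "(1 / (r - b)) * (b - r) = - 1" using \<open>\<not> r \<le> b\<close> by (simp add: field_simps)
      then show ?thesis by (simp add: of_real_def)
    qed
    ultimately show False using proper by simp
  qed
  then have bdd: "bdd_above ?S" by (auto intro: bdd_aboveI[of _ b])
  define r where "r = Sup ?S"
  have "a - of_real r \<in> N"
  proof (rule maximal_closed)
    show "a - of_real r \<in> herm" using a by (auto intro: herm_intros)
    fix e :: real assume "e > 0"
    then have "r - e < Sup ?S" by (simp add: r_def)
    moreover have "?S \<noteq> {}" using ne by blast
    ultimately obtain s where s: "s \<in> ?S" "r - e < s" by (rule less_cSupE)
    have "a - of_real r + of_real e = (a - of_real s) + of_real (s - (r - e))" by simp
    also have "\<dots> \<in> N"
      using s by (intro qmodule_add[OF N] qmodule_of_real[OF N]) auto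
    finally show "a - of_real r + of_real e \<in> N" .
  qed
  moreover have "of_real r - a \<in> N"
  proof (rule maximal_closed)
    show "of_real r - a \<in> herm" using a by (auto intro: herm_intros)
    fix e :: real assume "e > 0"
    then have "r + e \<notin> ?S" using cSup_upper[OF _ bdd, of "r + e"] unfolding r_def by auto
    then have "- (a - of_real (r + e)) \<in> N"
      using maximal_total[of "a - of_real (r + e)"] a by (auto intro: herm_intros)
    then show "of_real r - a + of_real e \<in> N" by (simp add: algebra_simps)
  qed
  ultimately show ?thesis by blast
qed

text \<open>Modulo the support each hermitian element is a real number, unique because N contains no
  negative constant. Multiplicativity reflects that the support is an ideal.\<close>

lemma maximal_character: "\<exists>\<phi>. character \<phi> \<and> (\<forall>x\<in>N. \<phi> x \<ge> 0)"
proof -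
  define \<phi> where "\<phi> a = (SOME r. a - of_real r \<in> N \<and> of_real r - a \<in> N)" for a
  have \<phi>: "a - of_real (\<phi> a) \<in> N \<and> of_real (\<phi> a) - a \<in> N" if "a \<in> herm" for a
    unfolding \<phi>_def using scalar_part_exists[OF that] by (rule someI_ex)
  have neg: "\<not> r < 0" if "of_real r \<in> N" for r
  proof
    assume "r < 0"
    then have "(1 / - r) *\<^sub>R of_real r = (- 1 :: 'a)" by (simp add: of_real_def)
    then show False using qmodule_scaleR[OF N that, of "1 / - r"] \<open>r < 0\<close> proper by simp
  qed
  have uniq: "r = s" if "a - of_real r \<in> N" "of_real r - a \<in> N" "a - of_real s \<in> N" "of_real s - a \<in> N" for a r s
  proof -
    have "of_real (s - r) \<in> N" using qmodule_add[OF N that(1,4)] by simp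
    moreover have "of_real (r - s) \<in> N" using qmodule_add[OF N that(3,2)] by simp
    ultimately show ?thesis using neg[of "r - s"] neg[of "s - r"] by simp
  qed
  have eqI: "\<phi> a = r" if "a \<in> herm" "a - of_real r \<in> N" "of_real r - a \<in> N" for a r
    using uniq \<phi>[OF that(1)] that(2,3) by blast
  have "\<phi> (a + b) = \<phi> a + \<phi> b" "\<phi> (a * b) = \<phi> a * \<phi> b" if ab: "a \<in> herm" "b \<in> herm" for a b
  proof -
    show "\<phi> (a + b) = \<phi> a + \<phi> b"
    proof (rule eqI)
      show "a + b \<in> herm" using ab by (rule herm_add)
      show "a + b - of_real (\<phi> a + \<phi> b) \<in> N"
        using qmodule_add[OF N, of "a - of_real (\<phi> a)" "b - of_real (\<phi> b)"] \<phi> ab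
        by (simp add: algebra_simps)
      show "of_real (\<phi> a + \<phi> b) - (a + b) \<in> N"
        using qmodule_add[OF N, of "of_real (\<phi> a) - a" "of_real (\<phi> b) - b"] \<phi> ab
        by (simp add: algebra_simps)
    qed
    have m: "u * v \<in> N" if "u \<in> herm" "v \<in> N" "- v \<in> N" for u v
      using that by (rule support_mult)
    show "\<phi> (a * b) = \<phi> a * \<phi> b"
    proof (rule eqI)
      show "a * b \<in> herm" using ab by (rule herm_mult)
      \<comment> \<open>The sum telescopes to ab - \<phi>(a)\<phi>(b), and each summand is a
        hermitian multiple of a support element.\<close>
      have "a * (b - of_real (\<phi> b)) + of_real (\<phi> b) * (a - of_real (\<phi> a)) \<in> N"
        using ab \<phi> by (intro qmodule_add[OF N] m) (auto intro: herm_intros)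
      then show "a * b - of_real (\<phi> a * \<phi> b) \<in> N"
        by (simp add: algebra_simps of_real_def mult.commute)
      have "a * (of_real (\<phi> b) - b) + of_real (\<phi> b) * (of_real (\<phi> a) - a) \<in> N"
        using ab \<phi> by (intro qmodule_add[OF N] m) (auto intro: herm_intros)
      then show "of_real (\<phi> a * \<phi> b) - a * b \<in> N"
        by (simp add: algebra_simps of_real_def mult.commute)
    qed
  qed
  moreover have "\<phi> (of_real r) = r" for r
    by (rule eqI) (auto intro: herm_intros qmodule_zero[OF N])
  moreover have "\<phi> x \<ge> 0" if x: "x \<in> N" for x
  proof -
    have "of_real (\<phi> x) - x \<in> N" using \<phi> qmodule_herm[OF N x] by blast
    from qmodule_add[OF N this x] have "of_real (\<phi> x) \<in> N" by simp
    then show ?thesis using neg[of "\<phi> x"] by simp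
  qed
  ultimately show ?thesis unfolding character_def by blast
qed

end

section \<open>Membership of elements that are positive under all characters\<close>

lemma archimedean_mono: "archimedean N \<Longrightarrow> N \<subseteq> N' \<Longrightarrow> archimedean N'"
  unfolding archimedean_def by blast

lemma character_exists:
  assumes "qmodule N" "archimedean N" "- 1 \<notin> N"
  shows "\<exists>\<phi>. character \<phi> \<and> (\<forall>x\<in>N. \<phi> x \<ge> 0)"
proof -
  obtain M where M: "qmodule M" "N \<subseteq> M" "- 1 \<notin> M"
    "\<And>N'. qmodule N' \<Longrightarrow> M \<subseteq> N' \<Longrightarrow> - 1 \<notin> N' \<Longrightarrow> N' = M"
    using qmodule_maximal_exists[OF assms(1,3)] by metis
  have "archimedean M" using archimedean_mono[OF assms(2) M(2)] .
  from maximal_character[OF M(1) this M(3,4)] show ?thesis using M(2) by blast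
qed

text \<open>After adjoining -f no nonnegative character remains, so -1 is represented and tf - 1
  lies in N for some sum of squares t. Dividing by t is impossible; instead, a bound on t improves f
  + r in N to f + r - 1/k^2 in N, and finitely many such improvements reach f.\<close>

lemma positivstellensatz:
  assumes N: "qmodule N" and arch: "archimedean N" and f: "f \<in> herm"
    and pos: "\<And>\<phi>. character \<phi> \<Longrightarrow> (\<forall>x\<in>N. \<phi> x \<ge> 0) \<Longrightarrow> \<phi> f > 0"
  shows "f \<in> N"
proof -
  let ?N' = "{x + t * (- f) |x t. x \<in> N \<and> t \<in> hsums}"
  have N': "qmodule ?N'" by (rule qmodule_adjoin[OF N herm_minus[OF f]])
  have sub: "N \<subseteq> ?N'" by (rule qmodule_adjoin_sup[OF N])
  have "- 1 \<in> ?N'"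
  proof (rule ccontr)
    assume "- 1 \<notin> ?N'"
    then obtain \<phi> where \<phi>: "character \<phi>" "\<forall>x\<in>?N'. \<phi> x \<ge> 0"
      using character_exists[OF N' archimedean_mono[OF arch sub]] by blast
    have "\<phi> (f + - f) = \<phi> f + \<phi> (- f)"
      using \<phi>(1) f herm_minus[OF f] unfolding character_def by blast
    moreover have "\<phi> 0 = 0" using \<phi>(1) unfolding character_def by (metis of_real_0)
    moreover have "\<phi> (- f) \<ge> 0" using \<phi>(2) qmodule_adjoin_mem[OF N, of "- f"] by blast
    moreover have "\<phi> f > 0" using pos \<phi> sub by blast
    ultimately show False by simp
  qed
  then obtain x t where x: "x \<in> N" and t: "t \<in> hsums" and xt: "x + t * (- f) = - 1"
    by (smt (verit) mem_Collect_eq)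
  have "1 + x = t * f" using xt by (simp add: algebra_simps)
  then have tf: "t * f - 1 \<in> N" using x by (metis add_diff_cancel_left')
  have th: "t \<in> herm" by (rule hsums_herm[OF t])
  have up: "of_real k - a \<in> N" if "of_real k0 - a \<in> N" "k0 \<le> k" for k0 k a
    using qmodule_add[OF N that(1) qmodule_of_real[OF N, of "k - k0"]] that(2) by simp
  obtain k1 where k1: "of_real k1 - t \<in> N" using arch th unfolding archimedean_def by blast
  obtain k2 where k2: "of_real k2 - (t * t * f + 1) \<in> N"
    using arch th f unfolding archimedean_def by (metis herm_add herm_mult herm_one)
  \<comment> \<open>One constant serves twice: the improvement uses both 2k - t and 2k - (t^2 f +
    1), and it divides by k^2.\<close>
  define k where "k = max 1 (max k1 k2)"
  have k: "k \<ge> 1" "of_real (2 * k) - t \<in> N" "of_real (2 * k) - (t * t * f + 1) \<in> N"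
    using up[OF k1, of "2 * k"] up[OF k2, of "2 * k"] by (auto simp: k_def)
  have step: "f + of_real (r - 1 / k\<^sup>2) \<in> N" if fr: "f + of_real r \<in> N" and r: "r \<ge> 0" for r
  proof -
    have "(of_real k - t) * (of_real k - t) \<in> hsums"
      using th by (intro hsums_square_herm) (auto intro: herm_intros)
    then have 1: "(of_real k - t) * (of_real k - t) * (f + of_real r) \<in> N"
      by (rule qmodule_hsums_mult[OF N _ fr])
    have 2: "(2 * k) *\<^sub>R (t * f - 1) \<in> N" using qmodule_scaleR[OF N tf] k(1) by simp
    have 3: "r *\<^sub>R (t * (of_real (2 * k) - t)) \<in> N"
      by (intro qmodule_scaleR[OF N] qmodule_hsums_mult[OF N] t k r)
    \<comment> \<open>The second and fourth summands remove the terms in tf and t^2 f from the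
      expanded square, the third removes those in rt and rt^2. What remains gains the constant -1,
      so the decrement of r after division by k^2 does not depend on r.\<close>
    have "(of_real k - t) * (of_real k - t) * (f + of_real r) + (2 * k) *\<^sub>R (t * f - 1)
        + r *\<^sub>R (t * (of_real (2 * k) - t)) + (of_real (2 * k) - (t * t * f + 1))
        = k\<^sup>2 *\<^sub>R f + of_real (k\<^sup>2 * r - 1)"
      unfolding power2_eq_square of_real_def
      by (simp add: algebra_simps) (simp only: mult_2_right distrib_left scaleR_left_distrib add.assoc)
    then have "k\<^sup>2 *\<^sub>R f + of_real (k\<^sup>2 * r - 1) \<in> N"
      using qmodule_add[OF N qmodule_add[OF N qmodule_add[OF N 1 2] 3] k(3)] by (simp only:)
    from qmodule_scaleR[OF N this, of "1 / k\<^sup>2"] k(1)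
    show ?thesis by (simp add: of_real_def scaleR_add_right right_diff_distrib)
  qed
  have drop: "f \<in> N" if "f + of_real r \<in> N" "r \<le> 0" for r
    using qmodule_add[OF N that(1) qmodule_of_real[OF N, of "- r"]] that(2) by simp
  \<comment> \<open>The improvement requires a nonnegative shift; once the shift is negative, f
    itself is in N, which the second alternative records.\<close>
  have desc: "f + of_real (r0 - real n * (1 / k\<^sup>2)) \<in> N \<or> f \<in> N" if "f + of_real r0 \<in> N" for r0 n
  proof (induction n)
    case (Suc n)
    show ?case
    proof (cases "r0 - real n * (1 / k\<^sup>2) \<ge> 0")
      case True
      then show ?thesis using Suc step[OF _ True] by (auto simp: algebra_simps add_divide_distrib)
    next
      case False
      then show ?thesis using Suc drop[of "r0 - real n * (1 / k\<^sup>2)"] by linarith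
    qed
  qed (use that in simp)
  obtain r0 where "of_real r0 - (- f) \<in> N"
    using arch herm_minus[OF f] unfolding archimedean_def by blast
  then have r0: "f + of_real r0 \<in> N" by (simp add: add.commute)
  obtain n where n: "real n * (1 / k\<^sup>2) > r0"
    using reals_Archimedean3[of "1 / k\<^sup>2"] k(1) by fastforce
  from desc[OF r0, of n] show "f \<in> N"
  proof
    assume "f + of_real (r0 - real n * (1 / k\<^sup>2)) \<in> N"
    then show ?thesis by (rule drop) (use n in simp)
  qed
qed

section \<open>Boundedness, which can be checked on generators\<close>

text \<open>Stated through \<open>star p * p\<close> because letters are not hermitian. The bounded
  elements are closed under sums and products and contain the reals, so bounds on the letters imply
  the archimedean property.\<close>

definition bounded_elements :: "'a set \<Rightarrow> 'a set" where
  "bounded_elements N = {p. \<exists>k\<ge>0. of_real k - star p * p \<in> N}"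

context
  fixes N assumes N: "qmodule N"
begin

lemma bounded_mult:
  assumes "p \<in> bounded_elements N" "q \<in> bounded_elements N"
  shows "p * q \<in> bounded_elements N"
proof -
  obtain k l where k: "k \<ge> 0" "of_real k - star p * p \<in> N" and l: "l \<ge> 0" "of_real l - star q * q \<in> N"
    using assms unfolding bounded_elements_def by blast
  have "star q * (of_real k - star p * p) * q + k *\<^sub>R (of_real l - star q * q) \<in> N"
    by (intro qmodule_add[OF N] qmodule_conj[OF N] qmodule_scaleR[OF N] k l)
  moreover have "star q * (of_real k - star p * p) * q + k *\<^sub>R (of_real l - star q * q)
      = of_real (k * l) - star (p * q) * (p * q)"
    unfolding of_real_def by (simp add: algebra_simps star_mult)
  ultimately show ?thesis
    unfolding bounded_elements_def using k(1) l(1) by (auto intro!: exI[of _ "k * l"])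
qed

text \<open>The parallelogram law: the square of p + q is at most twice the sum of the squares, the
  defect being the square of p - q.\<close>

lemma bounded_add:
  assumes "p \<in> bounded_elements N" "q \<in> bounded_elements N"
  shows "p + q \<in> bounded_elements N"
proof -
  obtain k l where k: "k \<ge> 0" "of_real k - star p * p \<in> N" and l: "l \<ge> 0" "of_real l - star q * q \<in> N"
    using assms unfolding bounded_elements_def by blast
  let ?s = "2 *\<^sub>R (of_real k - star p * p) + 2 *\<^sub>R (of_real l - star q * q) + star (p - q) * (p - q)"
  have "?s \<in> N"
    by (intro qmodule_add[OF N] qmodule_square[OF N] qmodule_scaleR[OF N] k l) auto
  moreover have "?s = of_real (2 * k + 2 * l) - star (p + q) * (p + q)"
    unfolding of_real_def by (simp add: algebra_simps star_add star_diff scaleR_2)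
  ultimately show ?thesis
    unfolding bounded_elements_def using k(1) l(1) by (auto intro!: exI[of _ "2 * k + 2 * l"])
qed

lemma bounded_of_real: "of_real r \<in> bounded_elements N"
  unfolding bounded_elements_def
  using qmodule_zero[OF N] by (auto intro!: exI[of _ "r * r"])

lemma archimedean_if_bounded:
  assumes "bounded_elements N = UNIV"
  shows "archimedean N"
  unfolding archimedean_def
proof
  fix a assume a: "a \<in> herm"
  obtain k where k: "of_real k - star a * a \<in> N"
    using assms unfolding bounded_elements_def by blast
  \<comment> \<open>Adding the square of a - 1 cancels the quadratic term and leaves k + 1 - 2a, a
    bound on a itself.\<close>
  have "of_real k - star a * a + star (a - 1) * (a - 1) \<in> N"
    by (intro qmodule_add[OF N] qmodule_square[OF N] k)
  moreover have "of_real k - star a * a + star (a - 1) * (a - 1) = 2 *\<^sub>R (of_real ((k + 1) / 2) - a)"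
  proof -
    have "2 *\<^sub>R (of_real ((k + 1) / 2) - a) = of_real (k + 1) - (a + a)"
      unfolding of_real_def scaleR_right_diff_distrib scaleR_scaleR by (simp add: scaleR_2)
    then show ?thesis using a by (simp add: herm_def star_diff algebra_simps)
  qed
  ultimately have "2 *\<^sub>R (of_real ((k + 1) / 2) - a) \<in> N" by (simp only:)
  from qmodule_scaleR[OF N this, of "1/2"] have "of_real ((k + 1) / 2) - a \<in> N" by simp
  then show "\<exists>k. of_real k - a \<in> N" ..
qed

end

section \<open>Positive characters come from quaternionic representations\<close>

context
  fixes \<phi> :: "'a \<Rightarrow> real"
  assumes char: "character \<phi>" and pos: "\<And>p. \<phi> (star p * p) \<ge> 0"
begin

lemma char_add: "a \<in> herm \<Longrightarrow> b \<in> herm \<Longrightarrow> \<phi> (a + b) = \<phi> a + \<phi> b"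
  and char_mult: "a \<in> herm \<Longrightarrow> b \<in> herm \<Longrightarrow> \<phi> (a * b) = \<phi> a * \<phi> b"
  and char_of_real: "\<phi> (of_real r) = r"
  using char by (auto simp: character_def)

lemma char_scaleR: "a \<in> herm \<Longrightarrow> \<phi> (r *\<^sub>R a) = r * \<phi> a"
  using char_mult[OF herm_of_real, of a r] by (simp add: char_of_real scaleR_conv_of_real)

lemma char_minus: "a \<in> herm \<Longrightarrow> \<phi> (- a) = - \<phi> a"
  using char_scaleR[of a "-1"] by simp

lemma char_diff: "a \<in> herm \<Longrightarrow> b \<in> herm \<Longrightarrow> \<phi> (a - b) = \<phi> a - \<phi> b"
  using char_add[of a "- b"] by (simp add: herm_minus char_minus)

text \<open>The inner factor \<open>star a * a\<close> is central and can be moved out.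
  Multiplicativity makes \<open>null\<close> a prime two-sided ideal.\<close>

lemma char_square_mult: "\<phi> (star (a * b) * (a * b)) = \<phi> (star a * a) * \<phi> (star b * b)"
proof -
  have "star (a * b) * (a * b) = star b * b * (star a * a)"
    using conj_herm[OF herm_square, of b a] by (simp add: star_mult mult.assoc)
  then show ?thesis by (simp add: char_mult herm_square)
qed

definition null :: "'a set" where
  "null = {p. \<phi> (star p * p) = 0}"

lemma null_zero: "0 \<in> null"
  using char_of_real[of 0] by (simp add: null_def)

lemma null_mult_left: "z \<in> null \<Longrightarrow> a * z \<in> null"
  and null_mult_right: "z \<in> null \<Longrightarrow> z * a \<in> null"
  and null_prime: "a * b \<in> null \<Longrightarrow> a \<in> null \<or> b \<in> null"
  by (auto simp: null_def char_square_mult)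

lemma null_scaleR: "z \<in> null \<Longrightarrow> r *\<^sub>R z \<in> null"
  using null_mult_left[of z "of_real r"] by (simp add: scaleR_conv_of_real)

lemma null_minus: "z \<in> null \<Longrightarrow> - z \<in> null"
  using null_scaleR[of z "-1"] by simp

lemma null_star: "z \<in> null \<Longrightarrow> star z \<in> null"
  by (simp add: null_def mult_star_commute)

text \<open>The parallelogram law replaces Cauchy-Schwarz: the two nonnegative values at p + q and p
  - q add up to zero.\<close>

lemma null_add:
  assumes "p \<in> null" "q \<in> null"
  shows "p + q \<in> null"
proof -
  have "star (p + q) * (p + q) + star (p - q) * (p - q) = 2 *\<^sub>R (star p * p) + 2 *\<^sub>R (star q * q)"
    by (simp add: algebra_simps star_add star_diff scaleR_2)
  then have "\<phi> (star (p + q) * (p + q) + star (p - q) * (p - q))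
      = \<phi> (2 *\<^sub>R (star p * p) + 2 *\<^sub>R (star q * q))"
    by simp
  then have "\<phi> (star (p + q) * (p + q)) + \<phi> (star (p - q) * (p - q)) = 0"
    using assms by (simp add: char_add herm_square herm_scaleR char_scaleR null_def)
  then show ?thesis using pos[of "p + q"] pos[of "p - q"] by (simp add: null_def)
qed

lemma null_diff: "p \<in> null \<Longrightarrow> q \<in> null \<Longrightarrow> p - q \<in> null"
  using null_add[of p "- q"] null_minus[of q] by simp

lemma null_herm: "a \<in> herm \<Longrightarrow> a \<in> null \<longleftrightarrow> \<phi> a = 0"
  using char_mult[of a a] by (simp add: null_def herm_def)

lemma null_of_real: "of_real r \<in> null \<longleftrightarrow> r = 0"
  by (simp add: null_herm herm_of_real char_of_real)

lemma null_cong_trans: "p - q \<in> null \<Longrightarrow> q - r \<in> null \<Longrightarrow> p - r \<in> null"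
  using null_add[of "p - q" "q - r"] by simp

lemma null_cong_mult:
  assumes "p - p' \<in> null" "q - q' \<in> null"
  shows "p * q - p' * q' \<in> null"
proof -
  have "p * q - p' * q' = (p - p') * q + p' * (q - q')" by (simp add: algebra_simps)
  then show ?thesis using assms null_add null_mult_left null_mult_right by simp
qed

definition quat_rep :: "('a \<Rightarrow> quat) \<Rightarrow> bool" where
  "quat_rep \<psi> \<longleftrightarrow> (\<forall>p q. \<psi> (p + q) = \<psi> p + \<psi> q) \<and> (\<forall>p q. \<psi> (p * q) = \<psi> p * \<psi> q) \<and>
     (\<forall>p. \<psi> (star p) = qcnj (\<psi> p)) \<and> (\<forall>a\<in>herm. \<psi> a = of_real (\<phi> a))"

text \<open>V is a copy of the reals, the complex numbers or all quaternions, and E lifts it to the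
  algebra, respecting the operations modulo \<open>null\<close>. If E reaches every class, its
  inverse is the representation; this one statement covers the three cases of Frobenius.\<close>

lemma quat_rep_of_section:
  fixes V :: "quat set" and E :: "quat \<Rightarrow> 'a"
  assumes V: "\<And>x y. x \<in> V \<Longrightarrow> y \<in> V \<Longrightarrow> x + y \<in> V" "\<And>x y. x \<in> V \<Longrightarrow> y \<in> V \<Longrightarrow> x - y \<in> V"
      "\<And>x y. x \<in> V \<Longrightarrow> y \<in> V \<Longrightarrow> x * y \<in> V" "\<And>x. x \<in> V \<Longrightarrow> qcnj x \<in> V" "\<And>r. of_real r \<in> V"
    and E: "\<And>x y. E (x + y) = E x + E y" "\<And>x y. E (x - y) = E x - E y" "\<And>r. E (of_real r) = of_real r"
    and E_mult: "\<And>x y. x \<in> V \<Longrightarrow> y \<in> V \<Longrightarrow> E x * E y - E (x * y) \<in> null"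
    and E_star: "\<And>x. x \<in> V \<Longrightarrow> star (E x) - E (qcnj x) \<in> null"
    and span: "\<And>p. \<exists>x\<in>V. p - E x \<in> null"
  shows "\<exists>\<psi>. quat_rep \<psi>"
proof -
  define \<psi> where "\<psi> p = (SOME x. x \<in> V \<and> p - E x \<in> null)" for p
  have \<psi>: "\<psi> p \<in> V" "p - E (\<psi> p) \<in> null" for p
    using someI_ex[of "\<lambda>x. x \<in> V \<and> p - E x \<in> null"] span[of p] unfolding \<psi>_def by blast+
  \<comment> \<open>Injectivity of E modulo \<open>null\<close>: multiplying by the lift of the
    conjugate reduces it to the scalar \<open>qnorm2 x\<close>.\<close>
  have zero: "x = 0" if x: "x \<in> V" "E x \<in> null" for x
  proof -
    have "E (qcnj x) * E x - E (qcnj x * x) \<in> null" using x V by (intro E_mult)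
    from null_diff[OF null_mult_left[OF x(2), of "E (qcnj x)"] this] have "E (of_real (qnorm2 x)) \<in> null"
      by (simp add: mult_qcnj)
    then have "qnorm2 x = 0" by (simp add: E null_of_real)
    then show ?thesis by (auto simp: qnorm2_def quat_eq_iff zero_quat_def add_nonneg_eq_0_iff)
  qed
  have eqI: "\<psi> p = x" if "x \<in> V" "p - E x \<in> null" for p x
  proof -
    have "E (\<psi> p - x) \<in> null"
      using null_diff[OF that(2) \<psi>(2)[of p]] by (simp add: E)
    then show ?thesis using zero[of "\<psi> p - x"] V(2) \<psi>(1) that(1) by simp
  qed
  have "\<psi> (p + q) = \<psi> p + \<psi> q" for p q
    using null_add[OF \<psi>(2)[of p] \<psi>(2)[of q]]
    by (intro eqI V \<psi>) (simp add: E algebra_simps)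
  moreover have "\<psi> (p * q) = \<psi> p * \<psi> q" for p q
    by (intro eqI V \<psi> null_cong_trans[OF null_cong_mult[OF \<psi>(2)[of p] \<psi>(2)[of q]]] E_mult)
  moreover have "\<psi> (star p) = qcnj (\<psi> p)" for p
    using null_star[OF \<psi>(2)[of p]]
    by (intro eqI V \<psi> null_cong_trans[OF _ E_star]) (simp add: star_diff)
  moreover have "\<psi> a = of_real (\<phi> a)" if a: "a \<in> herm" for a
    by (intro eqI V) (simp add: E null_herm herm_diff a herm_of_real char_diff char_of_real)
  ultimately show ?thesis unfolding quat_rep_def by blast
qed

section \<open>Orthonormal skew units and the quaternion frame\<close>

definition skew :: "'a set" where
  "skew = {u. star u = - u}"

lemma skew_intros:
  "u \<in> skew \<Longrightarrow> v \<in> skew \<Longrightarrow> u + v \<in> skew"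
  "u \<in> skew \<Longrightarrow> v \<in> skew \<Longrightarrow> u - v \<in> skew"
  "u \<in> skew \<Longrightarrow> r *\<^sub>R u \<in> skew"
  by (simp_all add: skew_def star_simps)

text \<open>The polarization of \<phi>(\<open>star u * u\<close>) on skew elements, whence the sign.
  Orthogonal skew elements are exactly those that anticommute modulo \<open>null\<close>.\<close>

definition ip :: "'a \<Rightarrow> 'a \<Rightarrow> real" where
  "ip u v = - \<phi> (u * v + v * u) / 2"

lemma anticomm_herm: "u \<in> skew \<Longrightarrow> v \<in> skew \<Longrightarrow> u * v + v * u \<in> herm"
  by (simp add: skew_def herm_def star_simps)

lemma ip_eq_0: "u \<in> skew \<Longrightarrow> v \<in> skew \<Longrightarrow> ip u v = 0 \<longleftrightarrow> u * v + v * u \<in> null"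
  by (simp add: ip_def null_herm anticomm_herm)

lemma ip_diff:
  assumes "u \<in> skew" "v \<in> skew" "w \<in> skew"
  shows "ip u (v - w) = ip u v - ip u w"
proof -
  have "u * (v - w) + (v - w) * u = (u * v + v * u) - (u * w + w * u)" by (simp add: algebra_simps)
  then show ?thesis by (simp add: ip_def char_diff anticomm_herm assms field_simps)
qed

lemma ip_scaleR:
  assumes "u \<in> skew" "v \<in> skew"
  shows "ip u (r *\<^sub>R v) = r * ip u v"
proof -
  have "u * (r *\<^sub>R v) + (r *\<^sub>R v) * u = r *\<^sub>R (u * v + v * u)" by (simp add: algebra_simps)
  then show ?thesis by (simp add: ip_def char_scaleR anticomm_herm assms)
qed

lemma ip_self:
  assumes "u \<in> skew"
  shows "ip u u = \<phi> (star u * u)"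
proof -
  have "u * u + u * u = (- 2) *\<^sub>R (star u * u)" using assms by (simp add: skew_def scaleR_2)
  then show ?thesis by (simp add: ip_def char_scaleR char_minus herm_square herm_scaleR)
qed

lemma ip_commute: "ip u v = ip v u"
  by (simp add: ip_def add.commute)

lemma skew_unit:
  assumes "u \<in> skew" "ip u u = 1"
  shows "u * u + 1 \<in> null"
proof -
  have uu: "u * u \<in> herm" using assms(1) by (simp add: skew_def herm_def star_mult)
  have "\<phi> (u * u) = - 1"
    using assms by (simp add: ip_def char_add[OF uu uu])
  then have "\<phi> (u * u + 1) = 0"
    using char_of_real[of 1] by (simp add: char_add uu herm_one)
  then show ?thesis by (simp add: null_herm uu herm_add herm_one)
qed

lemma skew_normalize:
  assumes "u \<in> skew" "u \<notin> null"
  obtains c where "c *\<^sub>R u \<in> skew" "ip (c *\<^sub>R u) (c *\<^sub>R u) = 1"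
proof -
  have "ip u u > 0" using assms pos[of u] by (simp add: ip_self null_def less_le)
  then have "(1 / sqrt (ip u u)) * ((1 / sqrt (ip u u)) * ip u u) = 1" by (simp add: field_simps)
  then show ?thesis
    using that[of "1 / sqrt (ip u u)"] assms(1)
    by (simp add: skew_intros ip_scaleR ip_commute[of "_ *\<^sub>R u" u])
qed

text \<open>The hermitian part of p agrees with its \<phi>-value modulo \<open>null\<close>, so only
  the skew part has to be expanded in units.\<close>

lemma null_skew_part: "\<exists>v\<in>skew. p - (of_real (\<phi> ((1/2) *\<^sub>R (p + star p))) + v) \<in> null"
proof
  let ?s = "(1/2) *\<^sub>R (p + star p)" and ?v = "(1/2) *\<^sub>R (p - star p)"
  show "?v \<in> skew" by (simp add: skew_def star_simps scaleR_right_diff_distrib)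
  have s: "?s \<in> herm" by (simp add: herm_def star_simps add.commute)
  have "p - ?v = ?s"
    by (simp add: algebra_simps) (simp flip: scaleR_left_distrib)
  then have "p - (of_real (\<phi> ?s) + ?v) = ?s - of_real (\<phi> ?s)" by (simp add: algebra_simps)
  also have "\<dots> \<in> null"
    using s by (simp add: null_herm herm_diff herm_of_real char_diff char_of_real)
  finally show "p - (of_real (\<phi> ?s) + ?v) \<in> null" .
qed

text \<open>The third unit is a separate argument because it equals the product of the first two
  only modulo \<open>null\<close>. Zeros in place of units give the real and complex cases.\<close>

definition frame_map :: "'a \<Rightarrow> 'a \<Rightarrow> 'a \<Rightarrow> quat \<Rightarrow> 'a" where
  "frame_map i j k x = of_real (qRe x) + qI x *\<^sub>R i + qJ x *\<^sub>R j + qK x *\<^sub>R k"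

lemma frame_map_add: "frame_map i j k (x + y) = frame_map i j k x + frame_map i j k y"
  and frame_map_diff: "frame_map i j k (x - y) = frame_map i j k x - frame_map i j k y"
  and frame_map_of_real: "frame_map i j k (of_real r) = of_real r"
  by (simp_all add: frame_map_def quat_defs of_real_quat algebra_simps)

text \<open>The nine brackets are the relations of the quaternion units; the map is multiplicative
  modulo \<open>null\<close> once each of them is null.\<close>

lemma frame_map_mult:
  "frame_map i j k x * frame_map i j k y - frame_map i j k (x * y) =
    (qI x * qI y) *\<^sub>R (i * i + 1) + (qJ x * qJ y) *\<^sub>R (j * j + 1) + (qK x * qK y) *\<^sub>R (k * k + 1)
    + (qI x * qJ y) *\<^sub>R (i * j - k) + (qJ x * qI y) *\<^sub>R (j * i + k)
    + (qJ x * qK y) *\<^sub>R (j * k - i) + (qK x * qJ y) *\<^sub>R (k * j + i)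
    + (qK x * qI y) *\<^sub>R (k * i - j) + (qI x * qK y) *\<^sub>R (i * k + j)"
  unfolding frame_map_def times_quat_def of_real_def by (simp add: algebra_simps)

lemma frame_map_star:
  assumes "i \<in> skew" "j \<in> skew" "k \<in> skew"
  shows "star (frame_map i j k x) = frame_map i j k (qcnj x)"
  using assms by (simp add: frame_map_def qcnj_def skew_def star_simps)

text \<open>Frobenius' theorem for the quotient by \<open>null\<close>: it is real, complex or quaternionic according to
  whether it contains no, one or three orthonormal skew units.\<close>

lemma quat_rep_exists: "\<exists>\<psi>. quat_rep \<psi>"
proof (cases "skew \<subseteq> null")
  case True
  show ?thesis
  proof (rule quat_rep_of_section[where V = "range of_real" and E = "frame_map 0 0 0"])
    show "\<exists>x\<in>range of_real. p - frame_map 0 0 0 x \<in> null" for p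
    proof -
      obtain v where v: "v \<in> skew" and p: "p - (of_real (\<phi> ((1/2) *\<^sub>R (p + star p))) + v) \<in> null"
        using null_skew_part by blast
      have "v \<in> null" using True v by blast
      from null_add[OF p this] show ?thesis by (auto simp: frame_map_of_real)
    qed
    show "star (frame_map 0 0 0 x) - frame_map 0 0 0 (qcnj x) \<in> null" for x
      by (simp add: frame_map_star skew_def null_zero)
  qed (auto simp: frame_map_add frame_map_diff frame_map_of_real qcnj_def null_zero
        simp flip: of_real_add of_real_diff of_real_mult, auto simp: of_real_quat)
next
  case False
  then obtain i where i: "i \<in> skew" "ip i i = 1" by (metis subsetI skew_normalize)
  have ii: "i * i + 1 \<in> null" by (rule skew_unit[OF i])
  show ?thesis
  proof (cases "\<forall>v\<in>skew. ip i v = 0 \<longrightarrow> v \<in> null")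
    case True
    let ?V = "{x. qJ x = 0 \<and> qK x = 0}" and ?E = "frame_map i 0 0"
    show ?thesis
    proof (rule quat_rep_of_section[where V = ?V and E = ?E])
      show "?E x * ?E y - ?E (x * y) \<in> null" if "x \<in> ?V" "y \<in> ?V" for x y
        using that null_scaleR[OF ii] by (simp add: frame_map_mult)
      show "star (?E x) - ?E (qcnj x) \<in> null" for x
        using i(1) by (simp add: frame_map_star skew_def null_zero)
      show "\<exists>x\<in>?V. p - ?E x \<in> null" for p
      proof -
        obtain v where v: "v \<in> skew" and p: "p - (of_real (\<phi> ((1/2) *\<^sub>R (p + star p))) + v) \<in> null"
          using null_skew_part by blast
        have "ip i (v - ip i v *\<^sub>R i) = 0"
          using v i by (simp add: ip_diff ip_scaleR skew_intros)
        then have "v - ip i v *\<^sub>R i \<in> null" using True v i by (simp add: skew_intros)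
        from null_add[OF p this] show ?thesis
          by (intro bexI[of _ "Quat (\<phi> ((1/2) *\<^sub>R (p + star p))) (ip i v) 0 0"])
            (simp_all add: frame_map_def algebra_simps)
      qed
    qed (simp_all only: frame_map_add frame_map_diff frame_map_of_real, simp_all add: qcnj_def quat_defs of_real_quat)
  next
    case False
    then obtain v where v: "v \<in> skew" "ip i v = 0" "v \<notin> null" by blast
    then obtain c where c: "c *\<^sub>R v \<in> skew" "ip (c *\<^sub>R v) (c *\<^sub>R v) = 1" using skew_normalize by metis
    define j where "j = c *\<^sub>R v"
    have j: "j \<in> skew" "ip j j = 1" "ip i j = 0"
      using c v i by (simp_all add: j_def ip_scaleR)
    have jj: "j * j + 1 \<in> null" by (rule skew_unit[OF j(1,2)])
    have ij: "i * j + j * i \<in> null" using ip_eq_0[OF i(1) j(1)] j(3) by blast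
    \<comment> \<open>The product ij is skew only modulo \<open>null\<close>; antisymmetrizing makes
      k exactly skew and changes ij by half the null anticommutator.\<close>
    define k where "k = (1/2) *\<^sub>R (i * j - j * i)"
    have k: "k \<in> skew" using i j by (simp add: k_def skew_def star_simps scaleR_right_diff_distrib)
    have "i * j - k = (1/2) *\<^sub>R (i * j + j * i)"
      unfolding k_def by (simp add: algebra_simps) (simp flip: scaleR_left_distrib)
    then have kij: "i * j - k \<in> null" using null_scaleR[OF ij, of "1/2"] by simp
    have "j * i + k = (1/2) *\<^sub>R (i * j + j * i)"
      unfolding k_def by (simp add: algebra_simps) (simp flip: scaleR_left_distrib)
    then have kji: "j * i + k \<in> null" using null_scaleR[OF ij, of "1/2"] by simp
    have jk: "j * k - i \<in> null"
    proof -
      have "j * k - i = j * (j * i + k) - (j * j + 1) * i" by (simp add: algebra_simps)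
      then show ?thesis using null_diff null_mult_left null_mult_right jj kji by simp
    qed
    have kj: "k * j + i \<in> null"
    proof -
      have "k * j + i = i * (j * j + 1) - (i * j - k) * j" by (simp add: algebra_simps)
      then show ?thesis using null_diff null_mult_left null_mult_right jj kij by simp
    qed
    have ki: "k * i - j \<in> null"
    proof -
      have "k * i - j = (j * i + k) * i - j * (i * i + 1)" by (simp add: algebra_simps)
      then show ?thesis using null_diff null_mult_left null_mult_right ii kji by simp
    qed
    have ik: "i * k + j \<in> null"
    proof -
      have "i * k + j = (i * i + 1) * j - i * (i * j - k)" by (simp add: algebra_simps)
      then show ?thesis using null_diff null_mult_left null_mult_right ii kij by simp
    qed
    have kk: "k * k + 1 \<in> null"
    proof -
      have "k * k + 1 = (i * i + 1) + i * (j * k - i) - (i * j - k) * k" by (simp add: algebra_simps)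
      then show ?thesis using null_add null_diff null_mult_left null_mult_right ii jk kij by (simp only:)
    qed
    have ip_ik: "ip i k = 0"
      using null_add[OF ik ki] using ip_eq_0[OF i(1) k] by (simp add: algebra_simps)
    have ip_jk: "ip j k = 0"
      using null_add[OF jk kj] using ip_eq_0[OF j(1) k] by (simp add: algebra_simps)
    have ip_kk: "ip k k = 1"
    proof -
      have h: "k * k \<in> herm" using k by (simp add: skew_def herm_def star_mult)
      have "\<phi> (k * k + 1) = 0" using kk by (simp add: null_herm h herm_add herm_one)
      then have "\<phi> (k * k) = - 1" using char_of_real[of 1] by (simp add: char_add h herm_one)
      then show ?thesis by (simp add: ip_def char_add h)
    qed
    then have "k \<notin> null" using k by (simp add: ip_self null_def)
    \<comment> \<open>There is no fourth unit: r anticommutes with i and j, hence commutes with k =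
      ij modulo \<open>null\<close>, but it also anticommutes with k. So kr is null, and primeness
      leaves only r.\<close>
    have complete: "r \<in> null" if r: "r \<in> skew" "ip i r = 0" "ip j r = 0" "ip k r = 0" for r
    proof -
      have ir: "i * r + r * i \<in> null" and jr: "j * r + r * j \<in> null" and kr: "k * r + r * k \<in> null"
        using ip_eq_0[OF i(1) r(1)] ip_eq_0[OF j(1) r(1)] ip_eq_0[OF k r(1)] r by blast+
      have "k * r - r * k = i * (j * r + r * j) - (i * r + r * i) * j - (i * j - k) * r + r * (i * j - k)"
        by (simp add: algebra_simps)
      then have "k * r - r * k \<in> null"
        using null_add null_diff null_mult_left null_mult_right ir jr kij by simp
      from null_scaleR[OF null_add[OF this kr], of "1/2"] have "k * r \<in> null"
        by (simp flip: scaleR_2)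
      then show ?thesis using null_prime \<open>k \<notin> null\<close> by blast
    qed
    let ?E = "frame_map i j k"
    show ?thesis
    proof (rule quat_rep_of_section[where V = UNIV and E = ?E])
      show "?E x * ?E y - ?E (x * y) \<in> null" for x y
        unfolding frame_map_mult by (intro null_add null_scaleR ii jj kk kij kji jk kj ki ik)
      show "star (?E x) - ?E (qcnj x) \<in> null" for x
        using i j k by (simp add: frame_map_star null_zero)
      show "\<exists>x\<in>UNIV. p - ?E x \<in> null" for p
      proof -
        obtain v where v: "v \<in> skew" and p: "p - (of_real (\<phi> ((1/2) *\<^sub>R (p + star p))) + v) \<in> null"
          using null_skew_part by blast
        have "v - ip i v *\<^sub>R i - ip j v *\<^sub>R j - ip k v *\<^sub>R k \<in> null"
          using v i(1) j(1) k i(2) j(2,3) ip_kk ip_ik ip_jk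
            ip_commute[of j i] ip_commute[of k i] ip_commute[of k j]
          by (intro complete) (simp_all add: skew_intros ip_diff ip_scaleR)
        from null_add[OF p this] show ?thesis
          by (intro bexI[of _ "Quat (\<phi> ((1/2) *\<^sub>R (p + star p))) (ip i v) (ip j v) (ip k v)"])
            (simp_all add: frame_map_def algebra_simps)
      qed
    qed (auto simp: frame_map_add frame_map_diff frame_map_of_real)
  qed
qed

end

end

section \<open>Words and noncommutative polynomials\<close>

lemma qcnj_simps:
  "qcnj (x + y) = qcnj x + qcnj y" "qcnj (x - y) = qcnj x - qcnj y"
  "qcnj (x * y) = qcnj y * qcnj x" "qcnj (r *\<^sub>R x) = r *\<^sub>R qcnj x"
  "qcnj (of_real r) = of_real r" "qcnj (qcnj x) = x" "qcnj 1 = 1" "qcnj 0 = 0"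
  by (simp_all add: qcnj_def quat_defs of_real_quat algebra_simps)

lemma word_star_star [simp]: "word_star (word_star w) = w"
  by transfer (simp add: list_star_def rev_map o_def)

lemma word_star_plus: "word_star (u + v) = word_star v + word_star u"
  by transfer (simp add: list_star_def)

lemma word_star_zero [simp]: "word_star 0 = 0"
  by transfer (simp add: list_star_def)

lemma word_star_letter [simp]: "word_star (letter x) = letter (bar x)"
  by transfer (simp add: list_star_def)

lemma word_induct [case_names zero plus]:
  assumes "P 0" and "\<And>x w. P w \<Longrightarrow> P (letter x + w)"
  shows "P w"
proof (induction w rule: qword.abs_induct)
  case (1 u)
  show ?case
  proof (induction u)
    case Nil
    then show ?case using assms(1) by (simp add: zero_qword_def)
  next
    case (Cons x u)
    have "abs_qword (x # u) = letter x + abs_qword u"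
      by (simp add: letter.abs_eq plus_qword.abs_eq)
    then show ?case using assms(2)[OF Cons] by simp
  qed
qed

lemma word_eval_plus: "word_eval a (u + v) = word_eval a u * word_eval a v"
  by transfer simp

lemma word_eval_zero [simp]: "word_eval a 0 = 1"
  by transfer simp

lemma word_eval_letter [simp]: "word_eval a (letter x) = letter_val a x"
  by transfer simp

lemma letter_val_bar_qcnj: "letter_val a (bar x) = qcnj (letter_val a x)"
  by (cases x) (simp_all add: qcnj_simps)

lemma word_eval_star: "word_eval a (word_star w) = qcnj (word_eval a w)"
  by (induction w rule: word_induct)
    (simp_all add: word_star_plus word_eval_plus letter_val_bar_qcnj qcnj_simps)

text \<open>The coefficient in the first case may be 0, so the zero polynomial needs no case of its
  own.\<close>

lemma qpoly_induct [case_names single add]: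
  fixes p :: "'w \<Rightarrow>\<^sub>0 'c::comm_monoid_add"
  assumes single: "\<And>w c. P (Poly_Mapping.single w c)" and add: "\<And>p q. P p \<Longrightarrow> P q \<Longrightarrow> P (p + q)"
  shows "P p"
proof (induction p rule: update_induct)
  case const
  then show ?case using single[of undefined 0] by simp
next
  case (update p w c)
  have "Poly_Mapping.update w c p = Poly_Mapping.single w c + p"
    using update(1) by (intro poly_mapping_eqI) (auto simp: lookup_update lookup_add lookup_single in_keys_iff)
  then show ?case using add[OF single update(3)] by simp
qed

lemma pstar_add: "pstar (p + q) = pstar p + pstar q"
  unfolding pstar_def by (rule setsum_keys_plus_distrib) (simp_all add: single_add)

lemma pstar_single [simp]: "pstar (Poly_Mapping.single w c) = Poly_Mapping.single (word_star w) c"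
  by (simp add: pstar_def)

lemma pstar_zero [simp]: "pstar 0 = 0"
  by (simp add: pstar_def)

lemma pstar_one [simp]: "pstar 1 = 1"
  using pstar_single[of 0 1] by simp

lemma pstar_minus: "pstar (- p) = - pstar p"
  using pstar_add[of p "- p"] by (simp add: eq_neg_iff_add_eq_0 add.commute)

lemma pstar_diff: "pstar (p - q) = pstar p - pstar q"
  using pstar_add[of p "- q"] by (simp add: pstar_minus)

lemma pstar_sum: "pstar (\<Sum>x\<in>A. F x) = (\<Sum>x\<in>A. pstar (F x))"
  by (induction A rule: infinite_finite_induct) (simp_all add: pstar_add)

lemma pstar_mult: "pstar (p * q) = pstar q * pstar p"
proof (induction p rule: qpoly_induct)
  case (single u a)
  show ?case
    by (induction q rule: qpoly_induct)
      (simp_all add: mult_single word_star_plus mult.commute distrib_left distrib_right pstar_add)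
qed (simp_all add: distrib_left distrib_right pstar_add)

lemma pstar_pstar [simp]: "pstar (pstar p) = p"
  by (induction p rule: qpoly_induct) (simp_all add: pstar_add)

lemmas pstar_simps = pstar_add pstar_minus pstar_diff pstar_mult

lemma rconst_commute: "rconst c * p = p * rconst c"
  by (induction p rule: qpoly_induct) (simp_all add: mult_single distrib_left distrib_right mult.commute)

lemma rconst_mult: "rconst (c * d) = rconst c * rconst d"
  by (simp add: mult_single)

lemma peval_add: "peval a (p + q) = peval a p + peval a q"
  unfolding peval_def by (rule setsum_keys_plus_distrib) (simp_all add: scaleR_left_distrib)

lemma peval_single: "peval a (Poly_Mapping.single w c) = c *\<^sub>R word_eval a w"
  by (simp add: peval_def)

lemma peval_zero [simp]: "peval a 0 = 0"
  by (simp add: peval_def)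

lemma peval_rconst [simp]: "peval a (rconst c) = of_real c"
  by (simp add: peval_single of_real_def)

lemma peval_minus: "peval a (- p) = - peval a p"
  using peval_add[of a p "- p"] by (simp add: eq_neg_iff_add_eq_0 add.commute)

lemma peval_diff: "peval a (p - q) = peval a p - peval a q"
  using peval_add[of a p "- q"] by (simp add: peval_minus)

lemma peval_mult: "peval a (p * q) = peval a p * peval a q"
proof (induction p rule: qpoly_induct)
  case (single u c)
  show ?case
    by (induction q rule: qpoly_induct)
      (simp_all add: mult_single word_eval_plus peval_single distrib_left peval_add mult.commute)
qed (simp_all add: distrib_right peval_add)

lemma peval_pstar: "peval a (pstar p) = qcnj (peval a p)"
  by (induction p rule: qpoly_induct)
    (simp_all add: peval_single word_eval_star pstar_add peval_add qcnj_simps)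

lemma riesz_add: "riesz y (p + q) = riesz y p + riesz y q"
  unfolding riesz_def by (rule setsum_keys_plus_distrib) (simp_all add: distrib_right)

lemma riesz_single [simp]: "riesz y (Poly_Mapping.single w c) = c * y w"
  by (simp add: riesz_def)

lemma riesz_zero [simp]: "riesz y 0 = 0"
  by (simp add: riesz_def)

lemma riesz_minus: "riesz y (- p) = - riesz y p"
  using riesz_add[of y p "- p"] by simp

lemma riesz_diff: "riesz y (p - q) = riesz y p - riesz y q"
  using riesz_add[of y p "- q"] by (simp add: riesz_minus)

lemma riesz_sum: "riesz y (\<Sum>x\<in>A. F x) = (\<Sum>x\<in>A. riesz y (F x))"
  by (induction A rule: infinite_finite_induct) (simp_all add: riesz_add)

lemma riesz_rconst_mult: "riesz y (rconst c * p) = c * riesz y p"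
  by (induction p rule: qpoly_induct) (simp_all add: mult_single distrib_left riesz_add)

section \<open>The ideal of central traces\<close>

text \<open>All letters occur here, although the moment relaxation only has commutators with $q_i$:
  those with $\bar q_i$ are their adjoints up to sign, but in general lie outside the ideal
  generated by the former.\<close>

inductive_set central_ideal :: "'n qpoly set" where
  zero: "0 \<in> central_ideal"
| add: "r \<in> central_ideal \<Longrightarrow>
    Poly_Mapping.single u c * commutator (wmono w + wmono (word_star w)) (wmono (letter x)) * wmono v + r
      \<in> central_ideal"

lemma central_ideal_gen:
  "Poly_Mapping.single u c * commutator (wmono w + wmono (word_star w)) (wmono (letter x)) * wmono v
    \<in> central_ideal"
  using central_ideal.add[OF central_ideal.zero] by simp

lemma central_ideal_add: "p \<in> central_ideal \<Longrightarrow> q \<in> central_ideal \<Longrightarrow> p + q \<in> central_ideal"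
  by (induction rule: central_ideal.induct) (auto intro: central_ideal.add simp: add.assoc)

lemma central_ideal_mult_left: "r \<in> central_ideal \<Longrightarrow> p * r \<in> central_ideal"
proof (induction rule: central_ideal.induct)
  case (add r u c w x v)
  have "p * (Poly_Mapping.single u c * commutator (wmono w + wmono (word_star w)) (wmono (letter x)) * wmono v)
      \<in> central_ideal" (is "_ * ?g \<in> _")
  proof (induction p rule: qpoly_induct)
    case (single w c)
    then show ?case by (simp add: mult.assoc[symmetric] mult_single central_ideal_gen)
  qed (simp add: distrib_right central_ideal_add)
  then show ?case using add by (simp add: distrib_left central_ideal_add)
qed (simp add: central_ideal.zero)

lemma central_ideal_mult_right: "r \<in> central_ideal \<Longrightarrow> r * p \<in> central_ideal"
proof (induction rule: central_ideal.induct)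
  case (add r u c w x v)
  have "Poly_Mapping.single u c * commutator (wmono w + wmono (word_star w)) (wmono (letter x)) * wmono v * p
      \<in> central_ideal"
  proof (induction p rule: qpoly_induct)
    case (single t d)
    let ?C = "commutator (wmono w + wmono (word_star w)) (wmono (letter x))"
    have "Poly_Mapping.single u c * ?C * wmono v * Poly_Mapping.single t d
        = rconst d * (Poly_Mapping.single u c * ?C * wmono (v + t))"
      unfolding rconst_commute[of d] by (simp add: mult.assoc mult_single)
    then show ?case by (simp add: central_ideal_mult_left central_ideal_gen)
  qed (simp add: distrib_left central_ideal_add)
  then show ?case using add by (simp add: distrib_right central_ideal_add)
qed (simp add: central_ideal.zero)

lemma central_ideal_minus: "r \<in> central_ideal \<Longrightarrow> - r \<in> central_ideal"
  using central_ideal_mult_left[of r "- 1"] by simp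

lemma central_ideal_diff: "p \<in> central_ideal \<Longrightarrow> q \<in> central_ideal \<Longrightarrow> p - q \<in> central_ideal"
  using central_ideal_add[of p "- q"] central_ideal_minus[of q] by simp

lemma pstar_commutator_gen:
  "pstar (commutator (wmono w + wmono (word_star w)) (wmono (letter x))) =
    - commutator (wmono w + wmono (word_star w)) (wmono (letter (bar x)))"
  by (simp add: commutator_def pstar_simps add.commute)

lemma central_ideal_pstar: "r \<in> central_ideal \<Longrightarrow> pstar r \<in> central_ideal"
proof (induction rule: central_ideal.induct)
  case (add r u c w x v)
  have "pstar (Poly_Mapping.single u c * commutator (wmono w + wmono (word_star w)) (wmono (letter x)) * wmono v)
      = wmono (word_star v) * - commutator (wmono w + wmono (word_star w)) (wmono (letter (bar x))) * Poly_Mapping.single (word_star u) c"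
    by (simp only: pstar_mult pstar_commutator_gen pstar_single mult.assoc)
  also have "\<dots> \<in> central_ideal"
    using central_ideal_gen[of 0 1 w "bar x" 0]
    by (intro central_ideal_mult_left central_ideal_mult_right central_ideal_minus) simp
  finally show ?case using add by (simp only: pstar_add central_ideal_add)
qed (simp add: central_ideal.zero)

text \<open>Only commutators with letters generate the ideal. The derivation rule [s, xv] = [s, x]v
  + x[s, v] extends them to words, and linearity in q and then in p does the rest.\<close>

lemma central_ideal_commutator: "(p + pstar p) * q - q * (p + pstar p) \<in> central_ideal"
proof -
  have letter: "(wmono w + wmono (word_star w)) * wmono v - wmono v * (wmono w + wmono (word_star w))
      \<in> central_ideal" for w v :: "'a qword"
  proof (induction v rule: word_induct)
    case zero
    then show ?case by (simp add: central_ideal.zero)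
  next
    case (plus x v)
    let ?s = "wmono w + wmono (word_star w)" and ?x = "wmono (letter x)"
    have x: "wmono (letter x + v) = ?x * (wmono v :: 'a qpoly)" by (simp add: mult_single)
    have "?s * (?x * wmono v) - (?x * wmono v) * ?s = commutator ?s ?x * wmono v + ?x * (?s * wmono v - wmono v * ?s)"
      by (simp add: commutator_def algebra_simps)
    also have "\<dots> \<in> central_ideal"
      using central_ideal_gen[of 0 1 w x v] by (simp add: central_ideal_add central_ideal_mult_left plus)
    finally show ?case by (simp only: x)
  qed
  have word: "(wmono w + wmono (word_star w)) * q - q * (wmono w + wmono (word_star w)) \<in> central_ideal" for w
  proof (induction q rule: qpoly_induct)
    case (single v c)
    have "Poly_Mapping.single v c = rconst c * wmono v" by (simp add: mult_single)
    moreover have "s * (rconst c * t) - rconst c * t * s = rconst c * (s * t - t * s)" for s t :: "'a qpoly"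
      by (simp only: right_diff_distrib mult.assoc[symmetric] rconst_commute[of c s])
    ultimately show ?case using central_ideal_mult_left[OF letter] by simp
  next
    case (add p q)
    from central_ideal_add[OF add] show ?case by (simp add: algebra_simps)
  qed
  show ?thesis
  proof (induction p rule: qpoly_induct)
    case (single w c)
    have "Poly_Mapping.single w c + pstar (Poly_Mapping.single w c) = rconst c * (wmono w + wmono (word_star w))"
      by (simp add: mult_single distrib_left)
    moreover have "rconst c * s * q - q * (rconst c * s) = rconst c * (s * q - q * s)" for s
      by (simp only: right_diff_distrib mult.assoc[symmetric] rconst_commute[of c q])
    ultimately show ?case using central_ideal_mult_left[OF word] by simp
  next
    case (add p p')
    from central_ideal_add[OF add] show ?case by (simp add: pstar_add algebra_simps)
  qed
qed

lemma qcnj_add_central: "(x + qcnj x) * y = y * (x + qcnj x)"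
proof -
  have "x + qcnj x = of_real (2 * qRe x)" by (simp add: qcnj_def quat_defs of_real_quat)
  then show ?thesis by (simp only: of_real_quat_commute)
qed

lemma central_ideal_vanishing: "central_ideal \<subseteq> vanishing_ideal"
proof
  fix r :: "'a qpoly" assume "r \<in> central_ideal"
  then show "r \<in> vanishing_ideal"
  proof (induction rule: central_ideal.induct)
    case (add r u c w x v)
    have "peval a (commutator (wmono w + wmono (word_star w)) (wmono (letter x))) = 0" for a
      using qcnj_add_central[of "word_eval a w"]
      by (simp add: commutator_def peval_diff peval_mult peval_add peval_single word_eval_star)
    then show ?case using add by (simp add: vanishing_ideal_def peval_add peval_mult)
  qed (simp add: vanishing_ideal_def)
qed

quotient_type 'n central_quot = "'n qpoly" / "\<lambda>p q. p - q \<in> central_ideal"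
proof (intro equivpI reflpI sympI transpI)
  fix p q r :: "'n qpoly"
  show "p - p \<in> central_ideal" by (simp add: central_ideal.zero)
  show "q - p \<in> central_ideal" if "p - q \<in> central_ideal" using central_ideal_minus[OF that] by simp
  show "p - r \<in> central_ideal" if "p - q \<in> central_ideal" "q - r \<in> central_ideal"
    using central_ideal_add[OF that] by simp
qed

instantiation central_quot :: (finite) real_algebra_1
begin

lift_definition zero_central_quot :: "'a central_quot" is 0 .
lift_definition one_central_quot :: "'a central_quot" is 1 .
lift_definition plus_central_quot :: "'a central_quot \<Rightarrow> 'a central_quot \<Rightarrow> 'a central_quot" is "(+)"
  subgoal for p p' q q' using central_ideal_add[of "p - p'" "q - q'"] by (simp add: algebra_simps)
  done
lift_definition minus_central_quot :: "'a central_quot \<Rightarrow> 'a central_quot \<Rightarrow> 'a central_quot" is "(-)"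
  subgoal for p p' q q' using central_ideal_diff[of "p - p'" "q - q'"] by (simp add: algebra_simps)
  done
lift_definition uminus_central_quot :: "'a central_quot \<Rightarrow> 'a central_quot" is uminus
  subgoal for p p' using central_ideal_minus[of "p - p'"] by simp
  done
lift_definition times_central_quot :: "'a central_quot \<Rightarrow> 'a central_quot \<Rightarrow> 'a central_quot" is "(*)"
  subgoal for p p' q q'
    using central_ideal_add[OF central_ideal_mult_right[of "p - p'" q] central_ideal_mult_left[of "q - q'" p']]
    by (simp add: algebra_simps)
  done
lift_definition scaleR_central_quot :: "real \<Rightarrow> 'a central_quot \<Rightarrow> 'a central_quot" is "\<lambda>c p. rconst c * p"
  subgoal for c p p' using central_ideal_mult_left[of "p - p'" "rconst c"] by (simp add: algebra_simps)
  done

instance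
proof
  note [simp] = central_ideal.zero
  fix a b c :: "'a central_quot" and r s :: real
  show "a + b + c = a + (b + c)" by transfer (simp add: add.assoc)
  show "a + b = b + a" by transfer (simp add: add.commute)
  show "0 + a = a" "- a + a = 0" "a - b = a + - b" "1 * a = a" "a * 1 = a" by (transfer; simp)+
  show "a * b * c = a * (b * c)" by transfer (simp add: mult.assoc)
  show "(a + b) * c = a * c + b * c" by transfer (simp add: distrib_right)
  show "a * (b + c) = a * b + a * c" by transfer (simp add: distrib_left)
  show "r *\<^sub>R (a + b) = r *\<^sub>R a + r *\<^sub>R b" by transfer (simp add: distrib_left)
  show "(r + s) *\<^sub>R a = r *\<^sub>R a + s *\<^sub>R a" by transfer (simp add: distrib_right single_add)
  show "r *\<^sub>R s *\<^sub>R a = (r * s) *\<^sub>R a" by transfer (simp add: rconst_mult mult.assoc)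
  show "1 *\<^sub>R a = a" by transfer simp
  show "r *\<^sub>R a * b = r *\<^sub>R (a * b)" by transfer (simp add: mult.assoc)
  show "a * r *\<^sub>R b = r *\<^sub>R (a * b)"
    by transfer (simp add: mult.assoc rconst_commute)
  show "(0 :: 'a central_quot) \<noteq> 1"
  proof (transfer, rule notI)
    assume "0 - 1 \<in> (central_ideal :: 'a qpoly set)"
    \<comment> \<open>Evaluation at the origin kills the ideal but not constants, so the quotient is
      nontrivial.\<close>
    then have "peval (\<lambda>_. 0) (0 - 1 :: 'a qpoly) = 0"
      using central_ideal_vanishing by (auto simp: vanishing_ideal_def)
    then show False using peval_rconst[of "\<lambda>_ :: 'a. 0" 1] by (simp add: peval_minus)
  qed
qed

end

lift_definition cstar :: "'n central_quot \<Rightarrow> 'n central_quot" is pstar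
  subgoal for p p' using central_ideal_pstar[of "p - p'"] by (simp add: pstar_diff)
  done

interpretation central_trace_algebra "cstar :: 'n::finite central_quot \<Rightarrow> 'n central_quot"
proof
  note [simp] = central_ideal.zero
  fix a b :: "'n central_quot" and r :: real
  show "cstar (cstar a) = a" by transfer simp
  show "cstar (a + b) = cstar a + cstar b" by transfer (simp add: pstar_add)
  show "cstar (a * b) = cstar b * cstar a" by transfer (simp add: pstar_mult)
  show "cstar (r *\<^sub>R a) = r *\<^sub>R cstar a" by transfer (simp add: pstar_mult rconst_commute)
  show "(a + cstar a) * b = b * (a + cstar a)" by transfer (rule central_ideal_commutator)
qed

section \<open>The quadratic module in the quotient\<close>

abbreviation proj :: "'n qpoly \<Rightarrow> 'n central_quot" where
  "proj \<equiv> abs_central_quot"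

lemma proj_add: "proj (p + q) = proj p + proj q"
  and proj_diff: "proj (p - q) = proj p - proj q"
  and proj_mult: "proj (p * q) = proj p * proj q"
  and proj_zero: "proj 0 = 0"
  and proj_one: "proj 1 = 1"
  and proj_star: "proj (pstar p) = cstar (proj p)"
  for p q :: "'n::finite qpoly"
  by (simp_all add: plus_central_quot.abs_eq minus_central_quot.abs_eq
      times_central_quot.abs_eq zero_central_quot_def one_central_quot_def cstar.abs_eq)

lemma proj_rconst: "proj (rconst c) = (of_real c :: 'n::finite central_quot)"
  by (simp add: of_real_def one_central_quot_def scaleR_central_quot.abs_eq)

lemma proj_eq_iff: "proj p = proj q \<longleftrightarrow> p - q \<in> central_ideal"
  by (rule central_quot.abs_eq_iff)

lemma proj_surj: obtains p where "a = proj p"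
  using central_quot.abs_induct[of "\<lambda>a. \<exists>p. a = proj p" a] by blast

lemma proj_sum: "proj (\<Sum>x\<in>A. F x) = (\<Sum>x\<in>A. proj (F x :: 'n::finite qpoly))"
  by (induction A rule: infinite_finite_induct) (simp_all add: proj_add proj_zero)

lemma proj_herm: "p \<in> Symp \<Longrightarrow> proj (p :: 'n::finite qpoly) \<in> herm"
  by (simp add: herm_def Symp_def flip: proj_star)

text \<open>The common shape of sums of squares and of the equality terms, giving both the same
  induction principle.\<close>

definition finite_sums :: "('b \<Rightarrow> 'a::comm_monoid_add) \<Rightarrow> 'a set" where
  "finite_sums F = {\<Sum>s<N. F (x s) | (N :: nat) x. True}"

lemma finite_sums_zero: "0 \<in> finite_sums F"
  unfolding finite_sums_def by (auto intro!: exI[of _ 0])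

lemma finite_sums_step:
  assumes "y \<in> finite_sums F"
  shows "y + F z \<in> finite_sums F"
proof -
  obtain N :: nat and x where y: "y = (\<Sum>s<N. F (x s))" using assms unfolding finite_sums_def by blast
  \<comment> \<open>Index N lies outside the old range, so it is free to carry the new
    summand.\<close>
  have "(\<Sum>s<N. F (x s)) = (\<Sum>s<N. F ((x(N := z)) s))" by (intro sum.cong) auto
  then have "y + F z = (\<Sum>s<Suc N. F ((x(N := z)) s))" by (simp add: y)
  then show ?thesis unfolding finite_sums_def by blast
qed

lemma finite_sums_induct [consumes 1, case_names zero step]:
  assumes "y \<in> finite_sums F" "P 0" "\<And>y z. y \<in> finite_sums F \<Longrightarrow> P y \<Longrightarrow> P (y + F z)"
  shows "P y"
proof -
  obtain N :: nat and x where y: "y = (\<Sum>s<N. F (x s))" using assms(1) unfolding finite_sums_def by blast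
  have "(\<Sum>s<N. F (x s)) \<in> finite_sums F \<and> P (\<Sum>s<N. F (x s))"
    by (induction N) (simp_all add: assms finite_sums_zero finite_sums_step)
  then show ?thesis by (simp add: y)
qed

lemma finite_sums_add: "y \<in> finite_sums F \<Longrightarrow> z \<in> finite_sums F \<Longrightarrow> z + y \<in> finite_sums F"
  by (induction rule: finite_sums_induct) (auto simp: add.assoc[symmetric] intro: finite_sums_step)

lemma finite_sums_single: "F z \<in> finite_sums F"
  using finite_sums_step[OF finite_sums_zero, of F z] by simp

lemma SOS_finite_sums: "SOS = finite_sums (\<lambda>p. pstar p * p)"
  unfolding SOS_def finite_sums_def ..

definition sym_mult :: "'n qpoly \<Rightarrow> 'n qpoly \<times> 'n qpoly \<Rightarrow> 'n qpoly" where
  "sym_mult h = (\<lambda>(\<tau>, \<nu>). \<tau> * h * \<nu> + pstar \<nu> * pstar h * pstar \<tau>)"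

lemma SOS_Symp: "\<sigma> \<in> SOS \<Longrightarrow> \<sigma> \<in> Symp"
  unfolding SOS_finite_sums Symp_def mem_Collect_eq
  by (induction rule: finite_sums_induct) (simp_all add: pstar_simps)

lemma sym_mult_Symp: "\<eta> \<in> finite_sums (sym_mult h) \<Longrightarrow> \<eta> \<in> Symp"
  unfolding Symp_def mem_Collect_eq
  by (induction rule: finite_sums_induct) (auto simp: sym_mult_def pstar_simps mult.assoc split: prod.splits)

text \<open>Hiding the double index of the equality terms in elements \<eta> reduces closure under
  sums and conjugation to closure of each component.\<close>

lemma quad_module_iff:
  "x \<in> quad_module m g l h \<longleftrightarrow> (\<exists>\<sigma> \<eta>. (\<forall>i\<in>{0..m}. \<sigma> i \<in> SOS) \<and>
     (\<forall>j\<in>{1..l}. \<eta> j \<in> finite_sums (sym_mult (h j))) \<and>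
     x = \<sigma> 0 + rconst (1/2) * (\<Sum>i=1..m. \<sigma> i * g i + g i * \<sigma> i) + (\<Sum>j=1..l. \<eta> j))"
proof
  assume "x \<in> quad_module m g l h"
  then obtain \<sigma> N \<tau> \<nu> where \<sigma>: "\<forall>i\<in>{0..m}. \<sigma> i \<in> SOS" and x: "x = qm_expr m g l h \<sigma> N \<tau> \<nu>"
    unfolding quad_module_def by blast
  let ?\<eta> = "\<lambda>j. \<Sum>\<alpha><N j. sym_mult (h j) (\<tau> j \<alpha>, \<nu> j \<alpha>)"
  have "\<forall>j\<in>{1..l}. ?\<eta> j \<in> finite_sums (sym_mult (h j))"
  proof
    fix j
    show "?\<eta> j \<in> finite_sums (sym_mult (h j))"
      unfolding finite_sums_def by (intro CollectI exI[of _ "N j"] exI[of _ "\<lambda>\<alpha>. (\<tau> j \<alpha>, \<nu> j \<alpha>)"]) simp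
  qed
  moreover have "x = \<sigma> 0 + rconst (1/2) * (\<Sum>i=1..m. \<sigma> i * g i + g i * \<sigma> i) + (\<Sum>j=1..l. ?\<eta> j)"
    unfolding x qm_expr_def sym_mult_def by simp
  ultimately show "\<exists>\<sigma> \<eta>. (\<forall>i\<in>{0..m}. \<sigma> i \<in> SOS) \<and> (\<forall>j\<in>{1..l}. \<eta> j \<in> finite_sums (sym_mult (h j))) \<and>
     x = \<sigma> 0 + rconst (1/2) * (\<Sum>i=1..m. \<sigma> i * g i + g i * \<sigma> i) + (\<Sum>j=1..l. \<eta> j)"
    using \<sigma> by (intro exI[of _ \<sigma>] exI[of _ ?\<eta>] conjI)
next
  assume "\<exists>\<sigma> \<eta>. (\<forall>i\<in>{0..m}. \<sigma> i \<in> SOS) \<and> (\<forall>j\<in>{1..l}. \<eta> j \<in> finite_sums (sym_mult (h j))) \<and>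
     x = \<sigma> 0 + rconst (1/2) * (\<Sum>i=1..m. \<sigma> i * g i + g i * \<sigma> i) + (\<Sum>j=1..l. \<eta> j)"
  then obtain \<sigma> \<eta> where \<sigma>: "\<forall>i\<in>{0..m}. \<sigma> i \<in> SOS" and \<eta>: "\<forall>j\<in>{1..l}. \<eta> j \<in> finite_sums (sym_mult (h j))"
    and x: "x = \<sigma> 0 + rconst (1/2) * (\<Sum>i=1..m. \<sigma> i * g i + g i * \<sigma> i) + (\<Sum>j=1..l. \<eta> j)" by blast
  have "\<forall>j\<in>{1..l}. \<exists>(N :: nat) z. \<eta> j = (\<Sum>\<alpha><N. sym_mult (h j) (z \<alpha>))"
    using \<eta> unfolding finite_sums_def by blast
  then obtain N z where Nz: "\<And>j. j \<in> {1..l} \<Longrightarrow> \<eta> j = (\<Sum>\<alpha><(N j :: nat). sym_mult (h j) (z j \<alpha>))"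
    by metis
  have "x = qm_expr m g l h \<sigma> N (\<lambda>j \<alpha>. fst (z j \<alpha>)) (\<lambda>j \<alpha>. snd (z j \<alpha>))"
    unfolding x qm_expr_def by (simp add: Nz sym_mult_def case_prod_unfold)
  then show "x \<in> quad_module m g l h" using \<sigma> unfolding quad_module_def by blast
qed

context
  fixes m l :: nat and g h :: "nat \<Rightarrow> 'n::finite qpoly"
  assumes g_Symp: "\<forall>i\<in>{1..m}. g i \<in> Symp"
begin

lemma quad_module_Symp: "x \<in> quad_module m g l h \<Longrightarrow> x \<in> Symp"
proof -
  assume "x \<in> quad_module m g l h"
  then obtain \<sigma> \<eta> where \<sigma>: "\<forall>i\<in>{0..m}. \<sigma> i \<in> SOS" and \<eta>: "\<forall>j\<in>{1..l}. \<eta> j \<in> finite_sums (sym_mult (h j))"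
    and x: "x = \<sigma> 0 + rconst (1/2) * (\<Sum>i=1..m. \<sigma> i * g i + g i * \<sigma> i) + (\<Sum>j=1..l. \<eta> j)"
    unfolding quad_module_iff by blast
  have "pstar (\<Sum>i=1..m. \<sigma> i * g i + g i * \<sigma> i) = (\<Sum>i=1..m. \<sigma> i * g i + g i * \<sigma> i)"
    unfolding pstar_sum
  proof (rule sum.cong)
    fix i assume "i \<in> {1..m}"
    then have "pstar (\<sigma> i) = \<sigma> i" "pstar (g i) = g i"
      using \<sigma> g_Symp SOS_Symp[of "\<sigma> i"] by (auto simp: Symp_def)
    then show "pstar (\<sigma> i * g i + g i * \<sigma> i) = \<sigma> i * g i + g i * \<sigma> i"
      by (simp add: pstar_simps add.commute)
  qed simp
  moreover have "pstar (\<Sum>j=1..l. \<eta> j) = (\<Sum>j=1..l. \<eta> j)"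
    unfolding pstar_sum
  proof (rule sum.cong)
    show "pstar (\<eta> j) = \<eta> j" if "j \<in> {1..l}" for j
      using \<eta> that sym_mult_Symp[of "\<eta> j" "h j"] by (auto simp: Symp_def)
  qed simp
  moreover have "pstar (\<sigma> 0) = \<sigma> 0" using \<sigma> SOS_Symp[of "\<sigma> 0"] by (auto simp: Symp_def)
  ultimately show "x \<in> Symp"
    by (simp add: x Symp_def pstar_add pstar_mult rconst_commute)
qed

definition qm_image :: "'n central_quot set" where
  "qm_image = proj ` quad_module m g l h"

text \<open>Each symmetric \<open>g i\<close> becomes central in the quotient, so the symmetrized
  products collapse to \<sigma> times \<open>g i\<close>.\<close>

lemma qm_image_iff:
  "z \<in> qm_image \<longleftrightarrow> (\<exists>\<sigma> \<eta>. (\<forall>i\<in>{0..m}. \<sigma> i \<in> SOS) \<and> (\<forall>j\<in>{1..l}. \<eta> j \<in> finite_sums (sym_mult (h j))) \<and>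
     z = proj (\<sigma> 0) + (\<Sum>i=1..m. proj (\<sigma> i) * proj (g i)) + (\<Sum>j=1..l. proj (\<eta> j)))"
proof -
  have eq: "proj (\<sigma> 0 + rconst (1/2) * (\<Sum>i=1..m. \<sigma> i * g i + g i * \<sigma> i) + (\<Sum>j=1..l. \<eta> j))
      = proj (\<sigma> 0) + (\<Sum>i=1..m. proj (\<sigma> i) * proj (g i)) + (\<Sum>j=1..l. proj (\<eta> j))"
    for \<sigma> \<eta>
  proof -
    have "(1/2) *\<^sub>R (\<Sum>i=1..m. proj (\<sigma> i) * proj (g i) + proj (g i) * proj (\<sigma> i))
        = (\<Sum>i=1..m. proj (\<sigma> i) * proj (g i))"
      unfolding scaleR_sum_right
    proof (rule sum.cong)
      fix i assume "i \<in> {1..m}"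
      then have "proj (g i) * proj (\<sigma> i) = proj (\<sigma> i) * proj (g i)"
        using g_Symp by (intro herm_central proj_herm) auto
      then show "(1/2) *\<^sub>R (proj (\<sigma> i) * proj (g i) + proj (g i) * proj (\<sigma> i)) = proj (\<sigma> i) * proj (g i)"
        by (simp flip: scaleR_2)
    qed simp
    then show ?thesis
      by (simp add: proj_add proj_mult proj_sum proj_rconst scaleR_conv_of_real)
  qed
  show ?thesis
    unfolding qm_image_def image_iff Bex_def quad_module_iff eq[symmetric] by blast
qed

lemma qm_image_SOS: "\<sigma> \<in> SOS \<Longrightarrow> proj \<sigma> \<in> qm_image"
  unfolding qm_image_iff SOS_finite_sums
  by (rule exI[of _ "\<lambda>i. if i = 0 then \<sigma> else 0"], rule exI[of _ "\<lambda>_. 0"])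
    (auto simp: finite_sums_zero proj_zero intro!: sum.neutral)

lemma qm_image_g: "i \<in> {1..m} \<Longrightarrow> proj (g i) \<in> qm_image"
  unfolding qm_image_iff SOS_finite_sums
  by (rule exI[of _ "\<lambda>k. if k = i then 1 else 0"], rule exI[of _ "\<lambda>_. 0"])
    (use finite_sums_single[of "\<lambda>p. pstar p * p" "1 :: 'n qpoly"] in
      \<open>auto simp: finite_sums_zero proj_zero proj_one if_distrib if_distribR cong: if_cong\<close>)

lemma qm_image_h: "j \<in> {1..l} \<Longrightarrow> proj (sym_mult (h j) z) \<in> qm_image"
  unfolding qm_image_iff SOS_finite_sums
  by (rule exI[of _ "\<lambda>_. 0"], rule exI[of _ "\<lambda>k. if k = j then sym_mult (h j) z else 0"])
    (auto simp: finite_sums_zero finite_sums_single proj_zero if_distrib if_distribR cong: if_cong)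

lemma SOS_conj: "\<sigma> \<in> SOS \<Longrightarrow> pstar p * \<sigma> * p \<in> SOS"
  unfolding SOS_finite_sums
proof (induction rule: finite_sums_induct)
  case (step \<sigma> q)
  have "pstar p * (\<sigma> + pstar q * q) * p = pstar p * \<sigma> * p + pstar (q * p) * (q * p)"
    by (simp add: pstar_mult algebra_simps)
  then show ?case using finite_sums_step[OF step.IH, of "q * p"] by simp
qed (simp add: finite_sums_zero)

lemma sym_mult_conj: "\<eta> \<in> finite_sums (sym_mult k) \<Longrightarrow> pstar p * \<eta> * p \<in> finite_sums (sym_mult k)"
proof (induction rule: finite_sums_induct)
  case (step \<eta> z)
  obtain \<tau> \<nu> where z: "z = (\<tau>, \<nu>)" by fastforce
  have "pstar p * (\<eta> + sym_mult k z) * p = pstar p * \<eta> * p + sym_mult k (pstar p * \<tau>, \<nu> * p)"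
    by (simp add: sym_mult_def z pstar_mult algebra_simps)
  then show ?case using finite_sums_step[OF step.IH, of "(pstar p * \<tau>, \<nu> * p)"] by simp
qed (simp add: finite_sums_zero)

lemma qmodule_qm_image: "qmodule qm_image"
  unfolding qmodule_def
proof (intro conjI ballI allI)
  show "qm_image \<subseteq> herm"
    unfolding qm_image_def using quad_module_Symp proj_herm by blast
  have "(1 :: 'n qpoly) \<in> SOS"
    using finite_sums_single[of "\<lambda>p. pstar p * p" "1 :: 'n qpoly"] by (simp add: SOS_finite_sums)
  then show "1 \<in> qm_image" using qm_image_SOS[of 1] by (simp add: proj_one)
next
  fix x y assume "x \<in> qm_image" "y \<in> qm_image"
  then obtain \<sigma> \<eta> \<sigma>' \<eta>' where \<sigma>: "\<forall>i\<in>{0..m}. \<sigma> i \<in> SOS" "\<forall>i\<in>{0..m}. \<sigma>' i \<in> SOS"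
    and \<eta>: "\<forall>j\<in>{1..l}. \<eta> j \<in> finite_sums (sym_mult (h j))" "\<forall>j\<in>{1..l}. \<eta>' j \<in> finite_sums (sym_mult (h j))"
    and xy: "x = proj (\<sigma> 0) + (\<Sum>i=1..m. proj (\<sigma> i) * proj (g i)) + (\<Sum>j=1..l. proj (\<eta> j))"
      "y = proj (\<sigma>' 0) + (\<Sum>i=1..m. proj (\<sigma>' i) * proj (g i)) + (\<Sum>j=1..l. proj (\<eta>' j))"
    unfolding qm_image_iff by blast
  show "x + y \<in> qm_image"
    unfolding qm_image_iff
    by (rule exI[of _ "\<lambda>i. \<sigma> i + \<sigma>' i"], rule exI[of _ "\<lambda>j. \<eta> j + \<eta>' j"])
      (use \<sigma> \<eta> in \<open>simp add: SOS_finite_sums finite_sums_add xy proj_add distrib_right sum.distrib\<close>)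
next
  fix x a :: "'n central_quot" assume "x \<in> qm_image"
  then obtain \<sigma> \<eta> where \<sigma>: "\<forall>i\<in>{0..m}. \<sigma> i \<in> SOS" and \<eta>: "\<forall>j\<in>{1..l}. \<eta> j \<in> finite_sums (sym_mult (h j))"
    and x: "x = proj (\<sigma> 0) + (\<Sum>i=1..m. proj (\<sigma> i) * proj (g i)) + (\<Sum>j=1..l. proj (\<eta> j))"
    unfolding qm_image_iff by blast
  obtain p where a: "a = proj p" by (rule proj_surj)
  have "cstar a * (proj (\<sigma> i) * proj (g i)) * a = proj (pstar p * \<sigma> i * p) * proj (g i)" if "i \<in> {1..m}" for i
  proof -
    have "proj (g i) * a = a * proj (g i)" using that g_Symp by (intro herm_central proj_herm) auto
    then show ?thesis by (simp add: a proj_mult proj_star mult.assoc)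
  qed
  then have eq: "cstar a * x * a = proj (pstar p * \<sigma> 0 * p) + (\<Sum>i=1..m. proj (pstar p * \<sigma> i * p) * proj (g i))
      + (\<Sum>j=1..l. proj (pstar p * \<eta> j * p))"
    by (simp add: x distrib_left distrib_right sum_distrib_left sum_distrib_right)
      (simp add: a proj_mult proj_star)
  show "cstar a * x * a \<in> qm_image"
    unfolding qm_image_iff
    by (rule exI[of _ "\<lambda>i. pstar p * \<sigma> i * p"], rule exI[of _ "\<lambda>j. pstar p * \<eta> j * p"])
      (use \<sigma> \<eta> in \<open>auto intro: SOS_conj sym_mult_conj simp: eq\<close>)
qed

text \<open>Adding the squares of the other variables to the Archimedean certificate isolates one
  variable; normality then treats a letter and its conjugate alike.\<close>

lemma qm_image_letter_bounded:
  assumes arch: "archimedean_qm m g l h"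
  shows "proj (wmono (letter x)) \<in> bounded_elements qm_image"
proof -
  obtain R where R: "R > 0" "rconst R - (\<Sum>i\<in>UNIV. qvar i * qvarbar i) \<in> quad_module m g l h"
    using arch unfolding archimedean_qm_def by blast
  let ?n = "\<lambda>i :: 'n. proj (qvar i) * cstar (proj (qvar i))"
  have star: "proj (qvarbar i) = cstar (proj (qvar i))" for i :: 'n
    using proj_star[of "qvar i"] by simp
  have "proj (rconst R - (\<Sum>i\<in>UNIV. qvar i * qvarbar i)) \<in> qm_image"
    using R(2) by (auto simp: qm_image_def)
  then have 1: "of_real R - (\<Sum>i\<in>UNIV. ?n i) \<in> qm_image"
    by (simp add: proj_diff proj_rconst proj_sum proj_mult star)
  have sq: "(\<Sum>i\<in>I. ?n i) \<in> qm_image" if "finite I" for I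
    using that
  proof (induction I)
    case (insert i I)
    then show ?case
      using qmodule_add[OF qmodule_qm_image qmodule_square[OF qmodule_qm_image]]
        mult_star_commute[of "proj (qvar i)"]
      by simp
  qed (simp add: qmodule_zero[OF qmodule_qm_image])
  have n: "of_real R - ?n i \<in> qm_image" for i
    using qmodule_add[OF qmodule_qm_image 1 sq[of "UNIV - {i}"]] by (simp add: sum.remove[of UNIV i])
  show ?thesis
  proof (cases x)
    case (Q i)
    then show ?thesis using R(1) n[of i] by (auto simp: bounded_elements_def mult_star_commute intro!: exI[of _ R])
  next
    case (Qbar i)
    then show ?thesis using R(1) n[of i] by (auto simp: bounded_elements_def star intro!: exI[of _ R])
  qed
qed

lemma archimedean_qm_image:
  assumes "archimedean_qm m g l h"
  shows "archimedean qm_image"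
proof (rule archimedean_if_bounded[OF qmodule_qm_image])
  note Q = qmodule_qm_image
  have word: "proj (wmono w) \<in> bounded_elements qm_image" for w
  proof (induction w rule: word_induct)
    case zero
    then show ?case using bounded_of_real[OF Q, of 1] by (simp add: proj_one)
  next
    case (plus x w)
    have "proj (wmono (letter x + w)) = proj (wmono (letter x)) * proj (wmono w)"
      by (simp add: mult_single flip: proj_mult)
    then show ?case using bounded_mult[OF Q qm_image_letter_bounded[OF assms] plus] by simp
  qed
  have "proj p \<in> bounded_elements qm_image" for p
  proof (induction p rule: qpoly_induct)
    case (single w c)
    have "proj (Poly_Mapping.single w c) = of_real c * proj (wmono w)"
      by (simp add: mult_single flip: proj_rconst proj_mult)
    then show ?case using bounded_mult[OF Q bounded_of_real[OF Q] word] by simp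
  qed (simp add: proj_add bounded_add[OF Q])
  then show "bounded_elements qm_image = UNIV" by (metis UNIV_eq_I proj_surj)
qed

text \<open>The coordinates of the point are the images of the variables under the quaternionic
  representation attached to \<phi>.\<close>

lemma character_point:
  assumes char: "character \<phi>" and nonneg: "\<forall>x\<in>qm_image. \<phi> x \<ge> 0"
  obtains a where "a \<in> feasible m g l h" "\<And>p. p \<in> Symp \<Longrightarrow> peval a p = of_real (\<phi> (proj p))"
proof -
  note Q = qmodule_qm_image
  have pos: "\<phi> (cstar p * p) \<ge> 0" for p using nonneg qmodule_square[OF Q] by blast
  obtain \<psi> where \<psi>: "quat_rep \<phi> \<psi>" using quat_rep_exists[OF char pos] by blast
  have \<psi>_add: "\<psi> (p + q) = \<psi> p + \<psi> q" and \<psi>_mult: "\<psi> (p * q) = \<psi> p * \<psi> q"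
    and \<psi>_star: "\<psi> (cstar p) = qcnj (\<psi> p)" and \<psi>_herm: "p \<in> herm \<Longrightarrow> \<psi> p = of_real (\<phi> p)" for p q
    using \<psi> unfolding quat_rep_def[OF char pos] by blast+
  have \<psi>_of_real: "\<psi> (of_real r) = of_real r" for r
    using \<psi>_herm[OF herm_of_real] char by (simp add: character_def)
  define a where "a i = \<psi> (proj (qvar i))" for i
  have letter: "\<psi> (proj (wmono (letter x))) = letter_val a x" for x
    using \<psi>_star[of "proj (qvar (idx x))"] proj_star[of "qvar (idx x)"] by (cases x) (simp_all add: a_def)
  have word: "\<psi> (proj (wmono w)) = word_eval a w" for w
  proof (induction w rule: word_induct)
    case zero
    then show ?case using \<psi>_of_real[of 1] by (simp add: proj_one)
  next
    case (plus x w)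
    have "proj (wmono (letter x + w)) = proj (wmono (letter x)) * proj (wmono w)"
      by (simp add: mult_single flip: proj_mult)
    then show ?case by (simp add: \<psi>_mult plus letter word_eval_plus)
  qed
  have eval: "\<psi> (proj p) = peval a p" for p
  proof (induction p rule: qpoly_induct)
    case (single w c)
    have "proj (Poly_Mapping.single w c) = of_real c * proj (wmono w)"
      by (simp add: mult_single flip: proj_rconst proj_mult)
    then show ?case by (simp add: \<psi>_mult \<psi>_of_real word peval_single scaleR_conv_of_real)
  qed (simp add: proj_add \<psi>_add peval_add)
  have sym: "peval a p = of_real (\<phi> (proj p))" if "p \<in> Symp" for p
    using \<psi>_herm[OF proj_herm[OF that]] by (simp add: eval)
  have "peval a (g i) \<in> \<real>\<^sub>\<ge>\<^sub>0" if "i \<in> {1..m}" for i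
    using sym[of "g i"] that g_Symp nonneg qm_image_g[OF that] by (simp add: nonneg_Reals_of_real_iff)
  moreover have "peval a (h j) = 0" if j: "j \<in> {1..l}" for j
  proof -
    have *: "\<phi> (proj (sym_mult (h j) (\<tau>, 1))) \<ge> 0" for \<tau>
      using nonneg qm_image_h[OF j] by blast
    have eq: "of_real (\<phi> (proj (sym_mult (h j) (\<tau>, 1)))) = peval a (sym_mult (h j) (\<tau>, 1))" for \<tau>
      using sym[OF sym_mult_Symp[OF finite_sums_single]] by simp
    have "qnorm2 (peval a (h j)) \<le> 0"
    proof -
      \<comment> \<open>The multipliers of \<open>h j\<close> are arbitrary; taking minus its
        adjoint gives an element of the module whose value is -2|h(a)|^2, which forces h(a) =
        0.\<close>
      have "peval a (sym_mult (h j) (- pstar (h j), 1)) =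
          - of_real (qnorm2 (peval a (h j))) - of_real (qnorm2 (peval a (h j)))"
        by (simp add: sym_mult_def peval_add peval_diff peval_mult peval_minus peval_pstar pstar_minus mult_qcnj)
      also have "\<dots> = of_real (- qnorm2 (peval a (h j)) - qnorm2 (peval a (h j)))"
        by (simp only: of_real_diff of_real_minus)
      finally have "\<phi> (proj (sym_mult (h j) (- pstar (h j), 1))) = - qnorm2 (peval a (h j)) - qnorm2 (peval a (h j))"
        unfolding eq[symmetric] of_real_eq_iff .
      then show ?thesis using *[of "- pstar (h j)"] by simp
    qed
    then have "qnorm2 (peval a (h j)) = 0" by (simp add: qnorm2_def antisym)
    then show ?thesis by (auto simp: qnorm2_def quat_eq_iff zero_quat_def add_nonneg_eq_0_iff)
  qed
  ultimately have "a \<in> feasible m g l h" by (simp add: feasible_def)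
  then show thesis using that sym by blast
qed

text \<open>The certificate holds modulo the ideal of central traces, hence both modulo the vanishing
  ideal and modulo the linear constraints of the moment relaxation.\<close>

theorem quaternionic_positivstellensatz:
  assumes arch: "archimedean_qm m g l h" and f: "f \<in> Symp"
    and pos: "\<And>a. a \<in> feasible m g l h \<Longrightarrow> qRe (peval a f) > 0"
  shows "\<exists>p\<in>quad_module m g l h. f - p \<in> central_ideal"
proof -
  have "proj f \<in> qm_image"
  proof (rule positivstellensatz[OF qmodule_qm_image archimedean_qm_image[OF arch] proj_herm[OF f]])
    fix \<phi> assume "character \<phi>" "\<forall>x\<in>qm_image. \<phi> x \<ge> 0"
    then obtain a where "a \<in> feasible m g l h" "peval a f = of_real (\<phi> (proj f))"
      using character_point f by metis
    with pos[of a] show "\<phi> (proj f) > 0" by (simp add: of_real_quat)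
  qed
  then show ?thesis by (auto simp: qm_image_def proj_eq_iff)
qed

end

section \<open>Convergence of the relaxations\<close>

lemma pdeg_le_iff: "pdeg p \<le> D \<longleftrightarrow> (\<forall>w\<in>Poly_Mapping.keys p. wlen w \<le> D)"
  by (auto simp: pdeg_def)

lemma sum_single_words:
  assumes "Poly_Mapping.keys p \<subseteq> S" "finite S"
  shows "(\<Sum>w\<in>S. Poly_Mapping.single w (Poly_Mapping.lookup p w)) = p"
proof (rule poly_mapping_eqI)
  fix k
  have "Poly_Mapping.lookup (\<Sum>w\<in>S. Poly_Mapping.single w (Poly_Mapping.lookup p w)) k
      = (\<Sum>w\<in>S. if w = k then Poly_Mapping.lookup p w else 0)"
    unfolding lookup_sum by (intro sum.cong) (auto simp: lookup_single)
  also have "\<dots> = Poly_Mapping.lookup p k"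
    using assms by (auto simp: in_keys_iff)
  finally show "Poly_Mapping.lookup (\<Sum>w\<in>S. Poly_Mapping.single w (Poly_Mapping.lookup p w)) k
      = Poly_Mapping.lookup p k" .
qed

lemma single_eq_rconst_mult: "Poly_Mapping.single w c = rconst c * wmono w"
  by (simp add: mult_single)

lemma single_mult_single:
  "Poly_Mapping.single u a * p * Poly_Mapping.single v b = rconst a * (rconst b * (wmono u * p * wmono v))"
proof -
  have "Poly_Mapping.single u a * p * Poly_Mapping.single v b = rconst a * (wmono u * p * wmono v * rconst b)"
  proof -
    have "Poly_Mapping.single v b = wmono v * rconst b" by (simp add: mult_single)
    then show ?thesis by (simp only: single_eq_rconst_mult[of u a] mult.assoc)
  qed
  then show ?thesis by (simp only: rconst_commute[of b])
qed

lemma riesz_quadratic: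
  assumes p: "p = (\<Sum>w\<in>S. Poly_Mapping.single w (x w))"
  shows "riesz y (pstar p * g * p) = (\<Sum>u\<in>S. \<Sum>v\<in>S. x u * localizing_matrix g y u v * x v)"
proof -
  have entry: "riesz y (Poly_Mapping.single (word_star u) (x u) * g * Poly_Mapping.single v (x v))
      = x u * localizing_matrix g y u v * x v" for u v
    unfolding single_mult_single[of _ "x u" _ _ "x v"]
    by (simp add: riesz_rconst_mult localizing_matrix_def)
  have "pstar p * g * p = (\<Sum>u\<in>S. \<Sum>v\<in>S. Poly_Mapping.single (word_star u) (x u) * g * Poly_Mapping.single v (x v))"
    by (simp add: p pstar_sum sum_distrib_left sum_distrib_right) (rule sum.swap)
  then show ?thesis by (simp add: riesz_sum entry)
qed

lemma moment_matrix_eq_localizing: "moment_matrix y = localizing_matrix 1 y"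
  by (simp add: fun_eq_iff moment_matrix_def localizing_matrix_def)

lemma riesz_quadratic_nonneg:
  assumes "psd_on S (localizing_matrix g y)" "Poly_Mapping.keys p \<subseteq> S" "finite S"
  shows "riesz y (pstar p * g * p) \<ge> 0"
  unfolding riesz_quadratic[OF sum_single_words[OF assms(2,3), symmetric]]
  using assms(1) by (simp add: psd_on_def)

text \<open>Vectors on the smaller index set are extended by zero.\<close>

lemma psd_on_subset:
  assumes "psd_on S M" "T \<subseteq> S" "finite S"
  shows "psd_on T M"
  unfolding psd_on_def
proof (intro conjI allI)
  show "\<forall>u\<in>T. \<forall>v\<in>T. M u v = M v u" using assms unfolding psd_on_def by blast
  fix x :: "'a \<Rightarrow> real"
  let ?x = "\<lambda>u. if u \<in> T then x u else 0"
  have "(\<Sum>u\<in>T. \<Sum>v\<in>T. x u * M u v * x v) = (\<Sum>u\<in>S. \<Sum>v\<in>S. ?x u * M u v * ?x v)"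
    using assms(2,3)
    by (intro sum.mono_neutral_cong_left ballI) (auto intro!: sum.mono_neutral_cong_left)
  also have "\<dots> \<ge> 0" using conjunct2[OF assms(1)[unfolded psd_on_def], THEN spec, of ?x] .
  finally show "(\<Sum>u\<in>T. \<Sum>v\<in>T. x u * M u v * x v) \<ge> 0" .
qed

lemma words_le_mono: "s \<le> t \<Longrightarrow> words_le s \<subseteq> words_le t"
  by (auto simp: words_le_def)

context
  fixes m l :: nat and g h :: "nat \<Rightarrow> 'n::finite qpoly"
  assumes g_Symp: "\<forall>i\<in>{1..m}. g i \<in> Symp"
begin

section \<open>Monotonicity in the relaxation order\<close>

lemma quad_module_deg_subset: "quad_module_deg m g l h d \<subseteq> quad_module m g l h"
proof
  fix x assume "x \<in> quad_module_deg m g l h d"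
  then obtain \<sigma> N \<tau> \<nu> where x: "x = qm_expr m g l h \<sigma> N \<tau> \<nu>" and "\<sigma> 0 \<in> SOS_deg d"
    "\<forall>i\<in>{1..m}. \<sigma> i \<in> SOS_deg (d - half_deg (g i))"
    unfolding quad_module_deg_def by blast
  then have "\<sigma> i \<in> SOS" if "i \<in> {0..m}" for i
    using that by (cases "i = 0") (auto simp: SOS_deg_def)
  then show "x \<in> quad_module m g l h" unfolding quad_module_def x by blast
qed

lemma SOS_deg_mono: "d \<le> d' \<Longrightarrow> SOS_deg d \<subseteq> SOS_deg d'"
  by (auto simp: SOS_deg_def)

lemma quad_module_deg_mono:
  assumes "d \<le> d'"
  shows "quad_module_deg m g l h d \<subseteq> quad_module_deg m g l h d'"
proof
  fix x assume "x \<in> quad_module_deg m g l h d"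
  then obtain \<sigma> N \<tau> \<nu> where x: "x = qm_expr m g l h \<sigma> N \<tau> \<nu>" and \<sigma>0: "\<sigma> 0 \<in> SOS_deg d"
    and \<sigma>: "\<forall>i\<in>{1..m}. \<sigma> i \<in> SOS_deg (d - half_deg (g i))"
    and deg: "\<forall>j\<in>{1..l}. \<forall>\<alpha><N j. pdeg (\<tau> j \<alpha>) + pdeg (\<nu> j \<alpha>) \<le> 2 * d - pdeg (h j)"
    unfolding quad_module_deg_def by blast
  have "\<sigma> 0 \<in> SOS_deg d'" using \<sigma>0 SOS_deg_mono[OF assms] by blast
  moreover have "\<forall>i\<in>{1..m}. \<sigma> i \<in> SOS_deg (d' - half_deg (g i))"
    using \<sigma> SOS_deg_mono[OF diff_le_mono[OF assms]] by blast
  moreover have "\<forall>j\<in>{1..l}. \<forall>\<alpha><N j. pdeg (\<tau> j \<alpha>) + pdeg (\<nu> j \<alpha>) \<le> 2 * d' - pdeg (h j)"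
  proof (intro ballI allI impI)
    fix j \<alpha> assume "j \<in> {1..l}" "\<alpha> < N j"
    then have "pdeg (\<tau> j \<alpha>) + pdeg (\<nu> j \<alpha>) \<le> 2 * d - pdeg (h j)" using deg by blast
    then show "pdeg (\<tau> j \<alpha>) + pdeg (\<nu> j \<alpha>) \<le> 2 * d' - pdeg (h j)" using assms by linarith
  qed
  ultimately show "x \<in> quad_module_deg m g l h d'" unfolding quad_module_deg_def x by blast
qed

text \<open>A fixed certificate has finitely many terms, so finitely many degree thresholds
  suffice.\<close>

lemma eventually_quad_module_deg:
  assumes "x \<in> quad_module m g l h"
  shows "\<forall>\<^sub>F d in sequentially. x \<in> quad_module_deg m g l h d"
proof -
  obtain \<sigma> N \<tau> \<nu> where x: "x = qm_expr m g l h \<sigma> N \<tau> \<nu>" and \<sigma>: "\<forall>i\<in>{0..m}. \<sigma> i \<in> SOS"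
    using assms unfolding quad_module_def by blast
  have SOS: "\<forall>\<^sub>F d in sequentially. s \<in> SOS_deg (d - k)" if "s \<in> SOS" for s :: "'n qpoly" and k
    using eventually_ge_at_top[of "pdeg s + k"]
    by eventually_elim (use that in \<open>auto simp: SOS_deg_def\<close>)
  have 0: "\<forall>\<^sub>F d in sequentially. \<sigma> 0 \<in> SOS_deg d"
    using SOS[of "\<sigma> 0" 0] \<sigma> by simp
  have 1: "\<forall>\<^sub>F d in sequentially. \<forall>i\<in>{1..m}. \<sigma> i \<in> SOS_deg (d - half_deg (g i))"
    using \<sigma> by (intro eventually_ball_finite ballI SOS) auto
  have 2: "\<forall>\<^sub>F d in sequentially. \<forall>j\<in>{1..l}. \<forall>\<alpha>\<in>{..<N j}.
      pdeg (\<tau> j \<alpha>) + pdeg (\<nu> j \<alpha>) \<le> 2 * d - pdeg (h j)"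
  proof (intro eventually_ball_finite ballI)
    fix j \<alpha>
    show "\<forall>\<^sub>F d in sequentially. pdeg (\<tau> j \<alpha>) + pdeg (\<nu> j \<alpha>) \<le> 2 * d - pdeg (h j)"
      using eventually_ge_at_top[of "pdeg (\<tau> j \<alpha>) + pdeg (\<nu> j \<alpha>) + pdeg (h j)"]
      by eventually_elim auto
  qed simp_all
  from 0 1 2 show ?thesis
    by eventually_elim (unfold x quad_module_deg_def lessThan_iff Ball_def, blast)
qed

lemma moment_feasible_mono:
  assumes "d \<le> d'"
  shows "moment_feasible m g l h d' \<subseteq> moment_feasible m g l h d"
proof
  fix y assume y: "y \<in> moment_feasible m g l h d'"
  have "words_le (2 * d) \<subseteq> (words_le (2 * d') :: 'n qword set)" using assms by (intro words_le_mono) simp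
  then have "\<forall>w\<in>words_le (2 * d). y w = y (word_star w)"
    "\<forall>u\<in>words_le (2 * d). \<forall>v\<in>words_le (2 * d). cyc_equiv u v \<longrightarrow> y u = y v"
    using y unfolding moment_feasible_def by blast+
  moreover have "psd_on (words_le d) (moment_matrix y)"
    using y assms unfolding moment_feasible_def
    by (auto intro: psd_on_subset[OF _ words_le_mono finite_words_le])
  moreover have "psd_on (words_le (d - half_deg (g i))) (localizing_matrix (g i) y)" if "i \<in> {1..m}" for i
  proof -
    have "psd_on (words_le (d' - half_deg (g i))) (localizing_matrix (g i) y)"
      using y that unfolding moment_feasible_def by blast
    then show ?thesis
      by (rule psd_on_subset[OF _ words_le_mono finite_words_le]) (use assms in simp)
  qed
  moreover have "riesz y (wmono u * h j * wmono v) = 0" if "j \<in> {1..l}" "wlen u + wlen v \<le> 2 * d - pdeg (h j)" for j u v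
  proof -
    have "wlen u + wlen v \<le> 2 * d' - pdeg (h j)" using that(2) assms by simp
    then show ?thesis using y that(1) unfolding moment_feasible_def by blast
  qed
  moreover have "riesz y (wmono u * commutator (wmono w + wmono (word_star w)) (qvar i) * wmono v) = 0"
    if "wlen u + wlen v + wlen w + 1 \<le> 2 * d" for i u v w
  proof -
    have "wlen u + wlen v + wlen w + 1 \<le> 2 * d'" using that assms by simp
    then show ?thesis using y unfolding moment_feasible_def by blast
  qed
  moreover have "y 0 = 1" using y unfolding moment_feasible_def by blast
  ultimately show "y \<in> moment_feasible m g l h d"
    unfolding moment_feasible_def by (simp only: mem_Collect_eq) blast
qed

subsection \<open>Positivity of moment functionals of large order\<close>

lemma eventually_riesz_pstar:
  "\<forall>\<^sub>F d in sequentially. \<forall>y\<in>moment_feasible m g l h d. riesz y (pstar p) = riesz y p"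
proof (induction p rule: qpoly_induct)
  case (single w c)
  show ?case
    using eventually_ge_at_top[of "wlen w"]
  proof eventually_elim
    case (elim d)
    then have w: "w \<in> words_le (2 * d)" by (simp add: words_le_def)
    have eq: "y w = y (word_star w)" if "y \<in> moment_feasible m g l h d" for y
      using that w unfolding moment_feasible_def by blast
    show ?case by (simp add: eq[symmetric])
  qed
next
  case (add p q)
  then show ?case by eventually_elim (simp add: pstar_add riesz_add)
qed

text \<open>The relaxation imposes the commutators with \<open>Q i\<close> only; invariance of y
  under \<open>word_star\<close> transfers them to \<open>Qbar i\<close>, whose commutators are the
  negated adjoints.\<close>

lemma eventually_riesz_central_ideal:
  assumes "r \<in> central_ideal"
  shows "\<forall>\<^sub>F d in sequentially. \<forall>y\<in>moment_feasible m g l h d. riesz y r = 0"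
  using assms
proof (induction rule: central_ideal.induct)
  case (add r u c w x v)
  let ?C = "\<lambda>x. commutator (wmono w + wmono (word_star w)) (wmono (letter x))"
  have Q: "\<forall>\<^sub>F d in sequentially. \<forall>y\<in>moment_feasible m g l h d. riesz y (wmono u * ?C (Q i) * wmono v) = 0"
    for u v i
    using eventually_ge_at_top[of "wlen u + wlen v + wlen w + 1"]
    by eventually_elim (auto simp: moment_feasible_def)
  have "\<forall>\<^sub>F d in sequentially. \<forall>y\<in>moment_feasible m g l h d. riesz y (wmono u * ?C x * wmono v) = 0"
  proof (cases x)
    case (Qbar i)
    have "pstar (wmono u * ?C x * wmono v) = - (wmono (word_star v) * ?C (Q i) * wmono (word_star u))"
      by (simp add: Qbar pstar_mult pstar_commutator_gen mult.assoc)
    then have eq: "riesz y (pstar (wmono u * ?C x * wmono v)) = - riesz y (wmono (word_star v) * ?C (Q i) * wmono (word_star u))" for y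
      by (simp add: riesz_minus)
    from eventually_riesz_pstar[of "wmono u * ?C x * wmono v"] Q[of "word_star v" i "word_star u"]
    show ?thesis by eventually_elim (simp add: eq)
  qed (use Q in simp)
  then show ?case using add.IH
    by eventually_elim (simp add: riesz_add riesz_rconst_mult single_eq_rconst_mult[of u c] mult.assoc)
qed simp

text \<open>The quantifier over y stands inside the filter: the threshold is uniform in y, as the
  infimum in \<open>moment_value\<close> demands.\<close>

definition ev_nonneg :: "'n qpoly \<Rightarrow> bool" where
  "ev_nonneg p \<longleftrightarrow> (\<forall>\<^sub>F d in sequentially. \<forall>y\<in>moment_feasible m g l h d. riesz y p \<ge> 0)"

lemma ev_nonneg_add:
  assumes "ev_nonneg p" "ev_nonneg q"
  shows "ev_nonneg (p + q)"
  using assms unfolding ev_nonneg_def by eventually_elim (simp add: riesz_add)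

lemma ev_nonneg_zero: "ev_nonneg 0"
  by (simp add: ev_nonneg_def)

lemma ev_nonneg_sum: "(\<And>x. x \<in> A \<Longrightarrow> ev_nonneg (F x)) \<Longrightarrow> ev_nonneg (\<Sum>x\<in>A. F x)"
  by (induction A rule: infinite_finite_induct) (auto intro: ev_nonneg_add ev_nonneg_zero)

lemma ev_nonneg_central_ideal: "r \<in> central_ideal \<Longrightarrow> ev_nonneg r"
  using eventually_riesz_central_ideal unfolding ev_nonneg_def
  by (rule eventually_mono) auto

lemma ev_nonneg_square: "ev_nonneg (pstar p * p)"
  unfolding ev_nonneg_def
  using eventually_ge_at_top[of "pdeg p"]
proof eventually_elim
  case (elim d)
  have "riesz y (pstar p * 1 * p) \<ge> 0" if "y \<in> moment_feasible m g l h d" for y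
    using that elim finite_words_le
    by (intro riesz_quadratic_nonneg[of "words_le d"])
      (auto simp: moment_feasible_def moment_matrix_eq_localizing words_le_def pdeg_le_iff)
  then show ?case by simp
qed

lemma ev_nonneg_localizing:
  assumes i: "i \<in> {1..m}"
  shows "ev_nonneg (pstar p * g i * p)"
  unfolding ev_nonneg_def
  using eventually_ge_at_top[of "pdeg p + half_deg (g i)"]
proof eventually_elim
  case (elim d)
  then have p: "pdeg p \<le> d - half_deg (g i)" by simp
  show ?case
  proof (intro ballI riesz_quadratic_nonneg[OF _ _ finite_words_le])
    show "psd_on (words_le (d - half_deg (g i))) (localizing_matrix (g i) y)"
      if "y \<in> moment_feasible m g l h d" for y
      using that i unfolding moment_feasible_def by blast
    show "Poly_Mapping.keys p \<subseteq> words_le (d - half_deg (g i))"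
      using p by (auto simp: words_le_def pdeg_le_iff)
  qed
qed

lemma ev_nonneg_SOS: "\<sigma> \<in> SOS \<Longrightarrow> ev_nonneg \<sigma>"
  unfolding SOS_finite_sums
  by (induction rule: finite_sums_induct) (auto intro: ev_nonneg_add ev_nonneg_zero ev_nonneg_square)

text \<open>Localizing matrices control \<open>pstar p * g i * p\<close>, whereas the module
  contains symmetrized products. They differ by commutators with \<open>g i\<close>, which lie in
  the ideal because \<open>g i\<close> is symmetric.\<close>

lemma ev_nonneg_SOS_mult:
  assumes "\<sigma> \<in> SOS" and i: "i \<in> {1..m}"
  shows "ev_nonneg (\<sigma> * g i + g i * \<sigma>)"
  using assms(1) unfolding SOS_finite_sums
proof (induction rule: finite_sums_induct)
  case (step \<sigma> p)
  have central: "g i * q - q * g i \<in> central_ideal" for q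
  proof -
    have "proj (g i) * proj q = proj q * proj (g i)"
      using g_Symp i by (intro herm_central proj_herm) auto
    then show ?thesis by (simp add: proj_eq_iff flip: proj_mult)
  qed
  have "(\<sigma> + pstar p * p) * g i + g i * (\<sigma> + pstar p * p) =
      (\<sigma> * g i + g i * \<sigma>) + (pstar p * g i * p + pstar p * g i * p)
      + (- (pstar p * (g i * p - p * g i)) + (g i * pstar p - pstar p * g i) * p)"
    by (simp add: algebra_simps)
  moreover have "- (pstar p * (g i * p - p * g i)) + (g i * pstar p - pstar p * g i) * p \<in> central_ideal"
    by (intro central_ideal_add central_ideal_minus central_ideal_mult_left central_ideal_mult_right central)
  ultimately show ?case
    using ev_nonneg_add[OF ev_nonneg_add[OF step.IH ev_nonneg_add[OF ev_nonneg_localizing[OF i] ev_nonneg_localizing[OF i]]]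
        ev_nonneg_central_ideal] by simp
qed (simp add: ev_nonneg_zero)

lemma eventually_riesz_h:
  assumes "j \<in> {1..l}"
  shows "\<forall>\<^sub>F d in sequentially. \<forall>y\<in>moment_feasible m g l h d. riesz y (\<tau> * h j * \<nu>) = 0"
proof (induction \<tau> rule: qpoly_induct)
  case (single u a)
  show ?case
  proof (induction \<nu> rule: qpoly_induct)
    case (single v b)
    have "\<forall>\<^sub>F d in sequentially. \<forall>y\<in>moment_feasible m g l h d. riesz y (wmono u * h j * wmono v) = 0"
      using eventually_ge_at_top[of "wlen u + wlen v + pdeg (h j)"]
      by eventually_elim (use assms in \<open>auto simp: moment_feasible_def\<close>)
    then show ?case
      unfolding single_mult_single[of u a _ v b] by eventually_elim (simp add: riesz_rconst_mult)
  next
    case (add p q)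
    then show ?case by eventually_elim (simp add: distrib_left riesz_add)
  qed
next
  case (add p q)
  then show ?case by eventually_elim (simp add: distrib_right riesz_add)
qed

lemma ev_nonneg_sym_mult:
  assumes j: "j \<in> {1..l}" and "\<eta> \<in> finite_sums (sym_mult (h j))"
  shows "ev_nonneg \<eta>"
  using assms(2)
proof (induction rule: finite_sums_induct)
  case (step \<eta> z)
  obtain \<tau> \<nu> where z: "z = (\<tau>, \<nu>)" by fastforce
  have eq: "sym_mult (h j) z = \<tau> * h j * \<nu> + pstar (\<tau> * h j * \<nu>)"
    by (simp add: z sym_mult_def pstar_mult mult.assoc)
  have "ev_nonneg (sym_mult (h j) z)"
    unfolding ev_nonneg_def eq using eventually_riesz_h[OF j, of \<tau> \<nu>] eventually_riesz_pstar[of "\<tau> * h j * \<nu>"]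
    by eventually_elim (simp add: riesz_add)
  then show ?case using ev_nonneg_add step.IH by blast
qed (simp add: ev_nonneg_zero)

lemma ev_nonneg_quad_module:
  assumes "x \<in> quad_module m g l h"
  shows "ev_nonneg x"
proof -
  obtain \<sigma> \<eta> where \<sigma>: "\<forall>i\<in>{0..m}. \<sigma> i \<in> SOS" and \<eta>: "\<forall>j\<in>{1..l}. \<eta> j \<in> finite_sums (sym_mult (h j))"
    and x: "x = \<sigma> 0 + rconst (1/2) * (\<Sum>i=1..m. \<sigma> i * g i + g i * \<sigma> i) + (\<Sum>j=1..l. \<eta> j)"
    using assms unfolding quad_module_iff by blast
  have "ev_nonneg (\<Sum>i=1..m. \<sigma> i * g i + g i * \<sigma> i)"
    using \<sigma> by (intro ev_nonneg_sum ev_nonneg_SOS_mult) auto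
  then have "ev_nonneg (rconst (1/2) * (\<Sum>i=1..m. \<sigma> i * g i + g i * \<sigma> i))"
    unfolding ev_nonneg_def by eventually_elim (simp add: riesz_rconst_mult)
  moreover have "ev_nonneg (\<Sum>j=1..l. \<eta> j)"
    using \<eta> by (intro ev_nonneg_sum ev_nonneg_sym_mult) auto
  moreover have "ev_nonneg (\<sigma> 0)" using \<sigma> by (intro ev_nonneg_SOS) auto
  ultimately show ?thesis unfolding x by (intro ev_nonneg_add)
qed

subsection \<open>Point evaluations\<close>

lemma riesz_point: "riesz (\<lambda>w. qRe (word_eval a w)) p = qRe (peval a p)"
  by (induction p rule: qpoly_induct) (simp_all add: riesz_add peval_add peval_single quat_defs)

text \<open>The value of k at a is a real r >= 0, so the quadratic form equals r|p(a)|^2 for the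
  polynomial p whose coefficients are the vector.\<close>

lemma point_psd:
  assumes "k \<in> Symp" "peval a k \<in> \<real>\<^sub>\<ge>\<^sub>0"
  shows "psd_on S (localizing_matrix k (\<lambda>w. qRe (word_eval a w)))"
  unfolding psd_on_def
proof (intro conjI ballI allI)
  fix u v
  have "pstar (wmono (word_star u) * k * wmono v) = wmono (word_star v) * k * wmono u"
    using assms(1) by (simp add: Symp_def pstar_mult mult.assoc)
  then have "peval a (wmono (word_star v) * k * wmono u) = qcnj (peval a (wmono (word_star u) * k * wmono v))"
    by (simp flip: peval_pstar)
  then show "localizing_matrix k (\<lambda>w. qRe (word_eval a w)) u v = localizing_matrix k (\<lambda>w. qRe (word_eval a w)) v u"
    by (simp add: localizing_matrix_def riesz_point qcnj_def)
next
  fix x :: "'a qword \<Rightarrow> real"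
  define p where "p = (\<Sum>w\<in>S. Poly_Mapping.single w (x w))"
  obtain r where r: "r \<ge> 0" "peval a k = of_real r" using assms(2) by (auto elim: nonneg_Reals_cases)
  have "peval a (pstar p * k * p) = of_real r * (qcnj (peval a p) * peval a p)"
    by (simp add: peval_mult peval_pstar r of_real_quat_commute[symmetric] mult.assoc[symmetric])
  also have "\<dots> = of_real (r * qnorm2 (peval a p))" by (simp add: mult_qcnj)
  finally have "qRe (peval a (pstar p * k * p)) \<ge> 0"
    using r(1) by (simp only: of_real_quat quat.sel) (simp add: qnorm2_def)
  then show "(\<Sum>u\<in>S. \<Sum>v\<in>S. x u * localizing_matrix k (\<lambda>w. qRe (word_eval a w)) u v * x v) \<ge> 0"
    by (simp add: riesz_quadratic[OF p_def, symmetric] riesz_point)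
qed

lemma qRe_mult_commute: "qRe (x * y) = qRe (y * x)"
  by (simp add: times_quat_def)

lemma qRe_zero: "qRe 0 = 0"
  by (simp add: zero_quat_def)

text \<open>The real part is a trace on the quaternions, \<open>qRe (x * y) = qRe (y * x)\<close>,
  which gives cyclic invariance; its invariance under conjugation gives invariance under
  \<open>word_star\<close>.\<close>

lemma point_moment_feasible:
  assumes a: "a \<in> feasible m g l h"
  shows "(\<lambda>w. qRe (word_eval a w)) \<in> moment_feasible m g l h d"
proof -
  have "(1 :: 'n qpoly) \<in> Symp" "peval a 1 \<in> \<real>\<^sub>\<ge>\<^sub>0"
    using peval_rconst[of a 1] by (simp_all add: Symp_def)
  then have "psd_on (words_le d) (moment_matrix (\<lambda>w. qRe (word_eval a w)))"
    unfolding moment_matrix_eq_localizing by (rule point_psd)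
  moreover have "psd_on S (localizing_matrix (g i) (\<lambda>w. qRe (word_eval a w)))" if "i \<in> {1..m}" for i S
    using that a g_Symp by (intro point_psd) (auto simp: feasible_def)
  moreover have "peval a (h j) = 0" if "j \<in> {1..l}" for j
    using that a by (auto simp: feasible_def)
  moreover have "peval a (commutator (wmono w + wmono (word_star w)) q) = 0" for w q
    using qcnj_add_central[of "word_eval a w"]
    by (simp add: commutator_def peval_diff peval_mult peval_add peval_single word_eval_star)
  ultimately show ?thesis
    by (auto simp: moment_feasible_def riesz_point peval_mult word_eval_star qcnj_def cyc_equiv_def
        word_eval_plus qRe_mult_commute one_quat_def qRe_zero)
qed

text \<open>Point functionals are feasible at every order, so the positivity already proved for
  moment functionals of some large order applies to them.\<close>

lemma quad_module_point_nonneg: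
  assumes "p \<in> quad_module m g l h" "a \<in> feasible m g l h"
  shows "qRe (peval a p) \<ge> 0"
proof -
  obtain d where "\<forall>y\<in>moment_feasible m g l h d. riesz y p \<ge> 0"
    using ev_nonneg_quad_module[OF assms(1)] unfolding ev_nonneg_def eventually_sequentially by blast
  then show ?thesis using point_moment_feasible[OF assms(2)] by (auto simp flip: riesz_point)
qed

lemma moment_value_le: "moment_value f m g l h d \<le> f_min f m g l h"
  unfolding moment_value_def f_min_def
proof (rule INF_greatest)
  fix a assume "a \<in> feasible m g l h"
  from INF_lower[OF point_moment_feasible[OF this]]
  show "(INF y\<in>moment_feasible m g l h d. ereal (riesz y f)) \<le> ereal (qRe (peval a f))"
    by (metis riesz_point)
qed

lemma qsos_value_le: "qsos_value f m g l h d \<le> f_min f m g l h"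
  unfolding qsos_value_def f_min_def
proof (intro Sup_least INF_greatest)
  fix v a assume a: "a \<in> feasible m g l h"
  assume "v \<in> ereal ` {c. \<exists>p\<in>quad_module_deg m g l h d. \<exists>r\<in>vanishing_ideal \<inter> Symp \<inter> {r. pdeg r \<le> 2 * d}.
       f - rconst c = p + r}"
  then obtain c p r where c: "v = ereal c" and p: "p \<in> quad_module m g l h" and r: "r \<in> vanishing_ideal"
    and eq: "f - rconst c = p + r"
    using quad_module_deg_subset by blast
  have "peval a f - of_real c = peval a p"
    using arg_cong[OF eq, of "peval a"] r by (simp add: peval_diff peval_add vanishing_ideal_def)
  then have "qRe (peval a f) - c = qRe (peval a p)"
    by (metis minus_quat_def of_real_quat quat.sel(1))
  then show "v \<le> ereal (qRe (peval a f))"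
    using quad_module_point_nonneg[OF p a] by (simp add: c)
qed

lemma moment_value_mono: "d \<le> d' \<Longrightarrow> moment_value f m g l h d \<le> moment_value f m g l h d'"
  unfolding moment_value_def by (intro INF_superset_mono moment_feasible_mono order_refl)

lemma qsos_value_mono: "d \<le> d' \<Longrightarrow> qsos_value f m g l h d \<le> qsos_value f m g l h d'"
  unfolding qsos_value_def
  using quad_module_deg_mono[of d d'] by (intro Sup_subset_mono image_mono) fastforce

section \<open>Lower bounds from one fixed certificate\<close>

context
  fixes f :: "'n qpoly" and c :: real
  assumes arch: "archimedean_qm m g l h" and f: "f \<in> Symp" and c: "ereal c < f_min f m g l h"
begin

text \<open>The strict inequality makes f - c strictly positive on the feasible set. If that set is
  empty, \<open>f_min\<close> is infinite and every real c is certified, so both values tend to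
  infinity.\<close>

lemma certificate_exists: "\<exists>p\<in>quad_module m g l h. f - rconst c - p \<in> central_ideal"
proof (rule quaternionic_positivstellensatz[OF g_Symp arch])
  show "f - rconst c \<in> Symp" using f by (simp add: Symp_def pstar_diff)
  fix a assume "a \<in> feasible m g l h"
  with c have "ereal c < ereal (qRe (peval a f))" unfolding f_min_def by (rule less_INF_D)
  then show "qRe (peval a (f - rconst c)) > 0"
    by (simp add: peval_diff of_real_quat minus_quat_def)
qed

lemma eventually_moment_value_ge: "\<forall>\<^sub>F d in sequentially. ereal c \<le> moment_value f m g l h d"
proof -
  obtain p where p: "p \<in> quad_module m g l h" and r: "f - rconst c - p \<in> central_ideal"
    using certificate_exists by blast
  have "ev_nonneg (p + (f - rconst c - p))"
    by (intro ev_nonneg_add ev_nonneg_quad_module ev_nonneg_central_ideal p r)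
  then have "\<forall>\<^sub>F d in sequentially. \<forall>y\<in>moment_feasible m g l h d. riesz y (f - rconst c) \<ge> 0"
    by (simp add: ev_nonneg_def)
  then show ?thesis
  proof eventually_elim
    case (elim d)
    show ?case
      unfolding moment_value_def
    proof (rule INF_greatest)
      fix y assume "y \<in> moment_feasible m g l h d"
      moreover from this have "y 0 = 1" by (simp add: moment_feasible_def)
      ultimately show "ereal c \<le> ereal (riesz y f)" using elim by (fastforce simp: riesz_diff)
    qed
  qed
qed

lemma eventually_qsos_value_ge: "\<forall>\<^sub>F d in sequentially. ereal c \<le> qsos_value f m g l h d"
proof -
  obtain p where p: "p \<in> quad_module m g l h" and r: "f - rconst c - p \<in> central_ideal"
    using certificate_exists by blast
  let ?r = "f - rconst c - p"
  have "?r \<in> vanishing_ideal" using r central_ideal_vanishing by blast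
  \<comment> \<open>The QSOS relaxation admits only symmetric remainders; this one is a difference
    of symmetric elements.\<close>
  moreover have "?r \<in> Symp"
    using f quad_module_Symp[OF g_Symp p] by (simp add: Symp_def pstar_diff)
  ultimately have "\<forall>\<^sub>F d in sequentially. ?r \<in> vanishing_ideal \<inter> Symp \<inter> {r. pdeg r \<le> 2 * d}"
    by (intro eventually_mono[OF eventually_ge_at_top[of "pdeg ?r"]]) auto
  with eventually_quad_module_deg[OF p] show ?thesis
  proof eventually_elim
    case (elim d)
    have "f - rconst c = p + ?r" by simp
    then show ?case unfolding qsos_value_def using elim by (intro Sup_upper imageI CollectI bexI)
  qed
qed

end

end

theorem theorem6p1:
  fixes f :: "'n::finite qpoly" and m l :: nat and g h :: "nat \<Rightarrow> 'n qpoly"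
  assumes "f \<in> Symp"
    and "\<forall>i\<in>{1..m}. g i \<in> Symp"
    and "archimedean_qm m g l h"
  shows "mono_on (admissible f m g l h) (qsos_value f m g l h)
    \<and> qsos_value f m g l h \<longlonglongrightarrow> f_min f m g l h
    \<and> mono_on (admissible f m g l h) (moment_value f m g l h)
    \<and> moment_value f m g l h \<longlonglongrightarrow> f_min f m g l h"
proof -
  have lim: "X \<longlonglongrightarrow> f_min f m g l h"
    if le: "\<And>d. X d \<le> f_min f m g l h"
      and ge: "\<And>c. ereal c < f_min f m g l h \<Longrightarrow> \<forall>\<^sub>F d in sequentially. ereal c \<le> X d"
    for X :: "nat \<Rightarrow> ereal"
  proof (rule order_tendstoI)
    fix b assume "b < f_min f m g l h"
    \<comment> \<open>An intermediate real c makes the bound on X strict and also covers infinite b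
      or \<open>f_min\<close>.\<close>
    then obtain c where "b < ereal c" "ereal c < f_min f m g l h" using ereal_dense2 by blast
    then show "\<forall>\<^sub>F d in sequentially. b < X d"
      using ge[of c] by (auto elim!: eventually_mono intro: less_le_trans)
  next
    fix b assume "f_min f m g l h < b"
    then show "\<forall>\<^sub>F d in sequentially. X d < b" by (intro always_eventually allI le_less_trans[OF le])
  qed
  show ?thesis
    using assms
    by (intro conjI mono_onI qsos_value_mono moment_value_mono lim qsos_value_le moment_value_le
        eventually_qsos_value_ge eventually_moment_value_ge)
qed

end
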